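(* The inclusion functor $\mathrm{CExt}(\mathsf{Qnd})\hookrightarrow\mathrm{Ext}(\mathsf{Qnd})$ of the category of central extensions of quandles (equivalently, quandle coverings) into the category of extensions (surjective quandle homomorphisms) has a left adjoint, and $\mathrm{CExt}(\mathsf{Qnd})$ is a (regular epi)-reflective subcategory of $\mathrm{Ext}(\mathsf{Qnd})$, i.e. every component of the unit of this adjunction is a regular epimorphism in $\mathrm{Ext}(\mathsf{Qnd})$.
   Context: A quandle is a (possibly empty) set $A$ with two binary operations $\lhd,\lhd^{-1}$ such that for all $a,b,c\in A$: $a\lhd a=a$; $(a\lhd b)\lhd^{-1}b=a=(a\lhd^{-1}b)\lhd b$; $(a\lhd b)\lhd c=(a\lhd c)\lhd(b\lhd c)$. Homomorphisms preserve both operations; $\mathsf{Qnd}$ is the category of quandles. A quandle is trivial if $a\lhd a'=a=a\lhd^{-1}a'$ for all $a,a'$. For a quandle $A$, $\mathrm{Inn}(A)$ is the subgroup of $\mathrm{Aut}(A)$ generated by all right translations $a\mapsto a\lhd b$ ($b\in A$); $\pi_0(A)$ is the set of orbits of $A$ under $\mathrm{Inn}(A)$, regarded as a trivial quandle, and $\eta_A\colon A\to\pi_0(A)$ sends an element to its orbit. An extension is a surjective quandle homomorphism $f\colon A\to B$. It is trivial if the naturality square $\pi_0(f)\circ\eta_A=\eta_B\circ f$ is a pullback. It is central if there is a surjective homomorphism $p\colon E\to B$ such that the projection $E\times_B A\to E$ of the pullback of $f$ along $p$ is a trivial extension. It is a known result that $f$ is central if and only if it is a quandle covering: $f$ is surjective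 and $f(a)=f(a')$ implies $c\lhd a=c\lhd a'$ for all $c\in A$. $\mathrm{Ext}(\mathsf{Qnd})$ is the full subcategory of the arrow category $\mathsf{Qnd}^{\rightarrow}$ (objects: quandle homomorphisms; morphisms $f\to g$: pairs $(\alpha_1,\alpha_0)$ with $\alpha_0\circ f=g\circ\alpha_1$) whose objects are the extensions; $\mathrm{CExt}(\mathsf{Qnd})$ is its full subcategory of central extensions. A regular epimorphism is a coequalizer of some pair of parallel morphisms. *)

theory Defs
  imports "HOL-Algebra.Group_Action" "HOL-Algebra.Generated_Groups"
begin

section \<open>Categories\<close>

text \<open>
  Hom-sets of different pairs of objects need not be disjoint; composition and the action of
  a functor on morphisms therefore take the objects involved as arguments.
  \<open>Comp C X Y Z g f\<close> is the composite of \<open>f : X \<rightarrow> Y\<close> and \<open>g : Y \<rightarrow> Z\<close>.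
\<close>

record ('o, 'm) category =
  Obj :: "'o set"
  Hom :: "'o \<Rightarrow> 'o \<Rightarrow> 'm set"
  Id :: "'o \<Rightarrow> 'm"
  Comp :: "'o \<Rightarrow> 'o \<Rightarrow> 'o \<Rightarrow> 'm \<Rightarrow> 'm \<Rightarrow> 'm"

definition is_category :: "('o, 'm) category \<Rightarrow> bool" where
  "is_category C \<longleftrightarrow>
     (\<forall>X\<in>Obj C. Id C X \<in> Hom C X X) \<and>
     (\<forall>X\<in>Obj C. \<forall>Y\<in>Obj C. \<forall>Z\<in>Obj C. \<forall>f\<in>Hom C X Y. \<forall>g\<in>Hom C Y Z.
        Comp C X Y Z g f \<in> Hom C X Z) \<and>
     (\<forall>X\<in>Obj C. \<forall>Y\<in>Obj C. \<forall>f\<in>Hom C X Y.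
        Comp C X X Y f (Id C X) = f \<and> Comp C X Y Y (Id C Y) f = f) \<and>
     (\<forall>W\<in>Obj C. \<forall>X\<in>Obj C. \<forall>Y\<in>Obj C. \<forall>Z\<in>Obj C.
        \<forall>f\<in>Hom C W X. \<forall>g\<in>Hom C X Y. \<forall>h\<in>Hom C Y Z.
        Comp C W Y Z h (Comp C W X Y g f) = Comp C W X Z (Comp C X Y Z h g) f)"

definition full_subcategory :: "('o, 'm) category \<Rightarrow> ('o \<Rightarrow> bool) \<Rightarrow> ('o, 'm) category" where
  "full_subcategory C P = C\<lparr>Obj := {X \<in> Obj C. P X}\<rparr>"

definition arrow_category :: "('o, 'm) category \<Rightarrow> ('o \<times> 'o \<times> 'm, 'm \<times> 'm) category" where
  "arrow_category C =
     \<lparr>Obj = {(A, B, f). A \<in> Obj C \<and> B \<in> Obj C \<and> f \<in> Hom C A B},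
      Hom = (\<lambda>(A, B, f) (A', B', g).
        {(\<alpha>\<^sub>1, \<alpha>\<^sub>0). \<alpha>\<^sub>1 \<in> Hom C A A' \<and> \<alpha>\<^sub>0 \<in> Hom C B B' \<and>
           Comp C A B B' \<alpha>\<^sub>0 f = Comp C A A' B' g \<alpha>\<^sub>1}),
      Id = (\<lambda>(A, B, f). (Id C A, Id C B)),
      Comp = (\<lambda>(A, B, f) (A', B', g) (A'', B'', h) (\<beta>\<^sub>1, \<beta>\<^sub>0) (\<alpha>\<^sub>1, \<alpha>\<^sub>0).
        (Comp C A A' A'' \<beta>\<^sub>1 \<alpha>\<^sub>1, Comp C B B' B'' \<beta>\<^sub>0 \<alpha>\<^sub>0))\<rparr>"

record ('o1, 'm1, 'o2, 'm2) cat_functor =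
  fobj :: "'o1 \<Rightarrow> 'o2"
  fmap :: "'o1 \<Rightarrow> 'o1 \<Rightarrow> 'm1 \<Rightarrow> 'm2"

definition is_functor ::
    "('o1, 'm1) category \<Rightarrow> ('o2, 'm2) category \<Rightarrow> ('o1, 'm1, 'o2, 'm2) cat_functor \<Rightarrow> bool" where
  "is_functor C D F \<longleftrightarrow> is_category C \<and> is_category D \<and>
     (\<forall>X\<in>Obj C. fobj F X \<in> Obj D) \<and>
     (\<forall>X\<in>Obj C. \<forall>Y\<in>Obj C. \<forall>f\<in>Hom C X Y. fmap F X Y f \<in> Hom D (fobj F X) (fobj F Y)) \<and>
     (\<forall>X\<in>Obj C. fmap F X X (Id C X) = Id D (fobj F X)) \<and>
     (\<forall>X\<in>Obj C. \<forall>Y\<in>Obj C. \<forall>Z\<in>Obj C. \<forall>f\<in>Hom C X Y. \<forall>g\<in>Hom C Y Z.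
        fmap F X Z (Comp C X Y Z g f) =
          Comp D (fobj F X) (fobj F Y) (fobj F Z) (fmap F Y Z g) (fmap F X Y f))"

definition id_functor :: "('o, 'm, 'o, 'm) cat_functor" where
  "id_functor = \<lparr>fobj = (\<lambda>X. X), fmap = (\<lambda>X Y f. f)\<rparr>"

definition comp_functor ::
    "('o2, 'm2, 'o3, 'm3) cat_functor \<Rightarrow> ('o1, 'm1, 'o2, 'm2) cat_functor
      \<Rightarrow> ('o1, 'm1, 'o3, 'm3) cat_functor" where
  "comp_functor G F =
     \<lparr>fobj = (\<lambda>X. fobj G (fobj F X)),
      fmap = (\<lambda>X Y f. fmap G (fobj F X) (fobj F Y) (fmap F X Y f))\<rparr>"

text \<open>The inclusion of a full subcategory acts as the identity on objects and morphisms.\<close>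

abbreviation inclusion_functor :: "('o, 'm, 'o, 'm) cat_functor" where
  "inclusion_functor \<equiv> id_functor"

definition natural_transformation ::
    "('o1, 'm1) category \<Rightarrow> ('o2, 'm2) category
      \<Rightarrow> ('o1, 'm1, 'o2, 'm2) cat_functor \<Rightarrow> ('o1, 'm1, 'o2, 'm2) cat_functor
      \<Rightarrow> ('o1 \<Rightarrow> 'm2) \<Rightarrow> bool" where
  "natural_transformation C D F G \<tau> \<longleftrightarrow> is_functor C D F \<and> is_functor C D G \<and>
     (\<forall>X\<in>Obj C. \<tau> X \<in> Hom D (fobj F X) (fobj G X)) \<and>
     (\<forall>X\<in>Obj C. \<forall>Y\<in>Obj C. \<forall>f\<in>Hom C X Y.
        Comp D (fobj F X) (fobj F Y) (fobj G Y) (\<tau> Y) (fmap F X Y f) =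
        Comp D (fobj F X) (fobj G X) (fobj G Y) (fmap G X Y f) (\<tau> X))"

text \<open>\<open>F : C \<rightarrow> D\<close> is left adjoint to \<open>G : D \<rightarrow> C\<close>, with unit \<open>\<eta>\<close> and counit \<open>\<epsilon>\<close>.\<close>

definition adjunction ::
    "('o1, 'm1) category \<Rightarrow> ('o2, 'm2) category
      \<Rightarrow> ('o1, 'm1, 'o2, 'm2) cat_functor \<Rightarrow> ('o2, 'm2, 'o1, 'm1) cat_functor
      \<Rightarrow> ('o1 \<Rightarrow> 'm1) \<Rightarrow> ('o2 \<Rightarrow> 'm2) \<Rightarrow> bool" where
  "adjunction C D F G \<eta> \<epsilon> \<longleftrightarrow> is_functor C D F \<and> is_functor D C G \<and>
     natural_transformation C C id_functor (comp_functor G F) \<eta> \<and>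
     natural_transformation D D (comp_functor F G) id_functor \<epsilon> \<and>
     (\<forall>X\<in>Obj C.
        Comp D (fobj F X) (fobj F (fobj G (fobj F X))) (fobj F X)
          (\<epsilon> (fobj F X)) (fmap F X (fobj G (fobj F X)) (\<eta> X)) = Id D (fobj F X)) \<and>
     (\<forall>Y\<in>Obj D.
        Comp C (fobj G Y) (fobj G (fobj F (fobj G Y))) (fobj G Y)
          (fmap G (fobj F (fobj G Y)) Y (\<epsilon> Y)) (\<eta> (fobj G Y)) = Id C (fobj G Y))"

definition is_coequalizer ::
    "('o, 'm) category \<Rightarrow> 'o \<Rightarrow> 'o \<Rightarrow> 'm \<Rightarrow> 'm \<Rightarrow> 'o \<Rightarrow> 'm \<Rightarrow> bool" where
  "is_coequalizer C K X u v Y e \<longleftrightarrow>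
     K \<in> Obj C \<and> X \<in> Obj C \<and> Y \<in> Obj C \<and> u \<in> Hom C K X \<and> v \<in> Hom C K X \<and> e \<in> Hom C X Y \<and>
     Comp C K X Y e u = Comp C K X Y e v \<and>
     (\<forall>Z\<in>Obj C. \<forall>h\<in>Hom C X Z. Comp C K X Z h u = Comp C K X Z h v \<longrightarrow>
        (\<exists>!k. k \<in> Hom C Y Z \<and> Comp C X Y Z k e = h))"

definition regular_epi :: "('o, 'm) category \<Rightarrow> 'o \<Rightarrow> 'o \<Rightarrow> 'm \<Rightarrow> bool" where
  "regular_epi C X Y e \<longleftrightarrow> (\<exists>K u v. is_coequalizer C K X u v Y e)"


section \<open>Quandles\<close>

record 'a quandle = "'a partial_object" +
  qop :: "'a \<Rightarrow> 'a \<Rightarrow> 'a" (infixl "\<triangleleft>\<index>" 70)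
  qinv :: "'a \<Rightarrow> 'a \<Rightarrow> 'a" (infixl "\<triangleleft>\<inverse>\<index>" 70)

locale quandle =
  fixes A (structure)
  assumes op_closed: "\<lbrakk>a \<in> carrier A; b \<in> carrier A\<rbrakk> \<Longrightarrow> a \<triangleleft> b \<in> carrier A"
    and inv_closed: "\<lbrakk>a \<in> carrier A; b \<in> carrier A\<rbrakk> \<Longrightarrow> a \<triangleleft>\<inverse> b \<in> carrier A"
    and idem: "a \<in> carrier A \<Longrightarrow> a \<triangleleft> a = a"
    and op_inv: "\<lbrakk>a \<in> carrier A; b \<in> carrier A\<rbrakk> \<Longrightarrow> (a \<triangleleft> b) \<triangleleft>\<inverse> b = a"
    and inv_op: "\<lbrakk>a \<in> carrier A; b \<in> carrier A\<rbrakk> \<Longrightarrow> (a \<triangleleft>\<inverse> b) \<triangleleft> b = a"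
    and self_distrib: "\<lbrakk>a \<in> carrier A; b \<in> carrier A; c \<in> carrier A\<rbrakk>
      \<Longrightarrow> (a \<triangleleft> b) \<triangleleft> c = (a \<triangleleft> c) \<triangleleft> (b \<triangleleft> c)"

text \<open>
  Homomorphisms are extensional functions, so that equality of morphisms is equality of functions.
\<close>

definition quandle_hom :: "'a quandle \<Rightarrow> 'b quandle \<Rightarrow> ('a \<Rightarrow> 'b) set" where
  "quandle_hom A B = {f \<in> carrier A \<rightarrow>\<^sub>E carrier B. \<forall>a\<in>carrier A. \<forall>a'\<in>carrier A.
     f (a \<triangleleft>\<^bsub>A\<^esub> a') = f a \<triangleleft>\<^bsub>B\<^esub> f a' \<and> f (a \<triangleleft>\<inverse>\<^bsub>A\<^esub> a') = f a \<triangleleft>\<inverse>\<^bsub>B\<^esub> f a'}"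

definition quandle_iso :: "'a quandle \<Rightarrow> 'b quandle \<Rightarrow> ('a \<Rightarrow> 'b) set" where
  "quandle_iso A B = {f \<in> quandle_hom A B. bij_betw f (carrier A) (carrier B)}"

text \<open>Quandles whose underlying set is a subset of the type \<open>'u\<close>.\<close>

definition Qnd :: "('u quandle, 'u \<Rightarrow> 'u) category" where
  "Qnd = \<lparr>Obj = {A. quandle A}, Hom = quandle_hom, Id = (\<lambda>A. \<lambda>a\<in>carrier A. a),
          Comp = (\<lambda>A B C g f. compose (carrier A) g f)\<rparr>"


subsection \<open>Inner automorphisms and connected components\<close>

definition Aut_group :: "'a quandle \<Rightarrow> ('a \<Rightarrow> 'a) monoid" where
  "Aut_group A = (BijGroup (carrier A))\<lparr>carrier := quandle_iso A A\<rparr>"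

definition right_translation :: "'a quandle \<Rightarrow> 'a \<Rightarrow> 'a \<Rightarrow> 'a" where
  "right_translation A b = (\<lambda>a\<in>carrier A. a \<triangleleft>\<^bsub>A\<^esub> b)"

definition Inn_group :: "'a quandle \<Rightarrow> ('a \<Rightarrow> 'a) monoid" where
  "Inn_group A = (Aut_group A)
     \<lparr>carrier := generate (Aut_group A) (right_translation A ` carrier A)\<rparr>"

definition pi0 :: "'a quandle \<Rightarrow> 'a set quandle" where
  "pi0 A = \<lparr>carrier = orbits (Inn_group A) (carrier A) (\<lambda>\<phi>. \<phi>),
            qop = (\<lambda>x y. x), qinv = (\<lambda>x y. x)\<rparr>"

definition pi0_unit :: "'a quandle \<Rightarrow> 'a \<Rightarrow> 'a set" where
  "pi0_unit A = (\<lambda>a\<in>carrier A. orbit (Inn_group A) (\<lambda>\<phi>. \<phi>) a)"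

text \<open>
  A homomorphism maps each orbit of its domain into a single orbit of its codomain, so the
  description below is well defined.
\<close>

definition pi0_map :: "'a quandle \<Rightarrow> 'b quandle \<Rightarrow> ('a \<Rightarrow> 'b) \<Rightarrow> 'a set \<Rightarrow> 'b set" where
  "pi0_map A B f = (\<lambda>X\<in>carrier (pi0 A). THE Y. Y \<in> carrier (pi0 B) \<and> f ` X \<subseteq> Y)"


subsection \<open>Pullbacks\<close>

definition pullback_quandle ::
    "'a quandle \<Rightarrow> 'b quandle \<Rightarrow> ('a \<Rightarrow> 'c) \<Rightarrow> ('b \<Rightarrow> 'c) \<Rightarrow> ('a \<times> 'b) quandle" where
  "pullback_quandle A B f g =
     \<lparr>carrier = {(a, b). a \<in> carrier A \<and> b \<in> carrier B \<and> f a = g b},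
      qop = (\<lambda>(a, b) (a', b'). (a \<triangleleft>\<^bsub>A\<^esub> a', b \<triangleleft>\<^bsub>B\<^esub> b')),
      qinv = (\<lambda>(a, b) (a', b'). (a \<triangleleft>\<inverse>\<^bsub>A\<^esub> a', b \<triangleleft>\<inverse>\<^bsub>B\<^esub> b'))\<rparr>"

text \<open>
  The square with \<open>f \<circ> p = g \<circ> q\<close>, where \<open>p : P \<rightarrow> A\<close>, \<open>q : P \<rightarrow> B\<close>, \<open>f : A \<rightarrow> C\<close>, \<open>g : B \<rightarrow> C\<close>, is a
  pullback if the comparison homomorphism to the canonical pullback of \<open>f\<close> and \<open>g\<close> is invertible.
\<close>

definition is_pullback_square ::
    "'p quandle \<Rightarrow> 'a quandle \<Rightarrow> 'b quandle \<Rightarrow> 'c quandle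
      \<Rightarrow> ('p \<Rightarrow> 'a) \<Rightarrow> ('p \<Rightarrow> 'b) \<Rightarrow> ('a \<Rightarrow> 'c) \<Rightarrow> ('b \<Rightarrow> 'c) \<Rightarrow> bool" where
  "is_pullback_square P A B C p q f g \<longleftrightarrow>
     p \<in> quandle_hom P A \<and> q \<in> quandle_hom P B \<and> f \<in> quandle_hom A C \<and> g \<in> quandle_hom B C \<and>
     compose (carrier P) f p = compose (carrier P) g q \<and>
     (\<lambda>x\<in>carrier P. (p x, q x)) \<in> quandle_iso P (pullback_quandle A B f g)"


subsection \<open>Extensions\<close>

definition extension :: "'a quandle \<Rightarrow> 'b quandle \<Rightarrow> ('a \<Rightarrow> 'b) \<Rightarrow> bool" where
  "extension A B f \<longleftrightarrow>
     quandle A \<and> quandle B \<and> f \<in> quandle_hom A B \<and> f ` carrier A = carrier B"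

definition trivial_extension :: "'a quandle \<Rightarrow> 'b quandle \<Rightarrow> ('a \<Rightarrow> 'b) \<Rightarrow> bool" where
  "trivial_extension A B f \<longleftrightarrow> extension A B f \<and>
     is_pullback_square A (pi0 A) B (pi0 B) (pi0_unit A) f (pi0_map A B f) (pi0_unit B)"

definition central_extension :: "'u quandle \<Rightarrow> 'u quandle \<Rightarrow> ('u \<Rightarrow> 'u) \<Rightarrow> bool" where
  "central_extension A B f \<longleftrightarrow> extension A B f \<and>
     (\<exists>(E :: 'u quandle) p. extension E B p \<and>
        trivial_extension (pullback_quandle E A p f) E
          (restrict fst (carrier (pullback_quandle E A p f))))"

type_synonym 'u quandle_arrow = "'u quandle \<times> 'u quandle \<times> ('u \<Rightarrow> 'u)"
type_synonym 'u quandle_square = "('u \<Rightarrow> 'u) \<times> ('u \<Rightarrow> 'u)"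

definition Ext_Qnd :: "('u quandle_arrow, 'u quandle_square) category" where
  "Ext_Qnd = full_subcategory (arrow_category Qnd) (\<lambda>(A, B, f). extension A B f)"

definition CExt_Qnd :: "('u quandle_arrow, 'u quandle_square) category" where
  "CExt_Qnd = full_subcategory Ext_Qnd (\<lambda>(A, B, f). central_extension A B f)"

end

theory Submission
  imports Defs
begin

text \<open>
  Central extensions are coverings, and coverings are stable under the evident quotient: dividing
  \<open>A\<close> by the congruence generated by all pairs \<open>(c \<lhd> a, c \<lhd> a')\<close> with \<open>f a = f a'\<close> gives a
  covering of \<open>B\<close>, through which every morphism from \<open>f\<close> to a covering factors uniquely. The quotient
  map, paired with the identity of \<open>B\<close>, is the coequalizer of its kernel pair over \<open>B\<close>. Units of an
  adjunction are universal arrows, hence isomorphic to this one.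

  That a covering \<open>f\<close> is central is shown without free quandles. It is trivialized by the quandle of
  transports between fibres of \<open>f\<close> (composites of translations of \<open>A\<close>, restricted to a fibre): a
  word of translations that fixes a transport \<open>e\<close> fixes all values of \<open>e\<close>, that is, the whole
  fibre over the endpoint of \<open>e\<close>.
\<close>

section \<open>Reflective subcategories\<close>

text \<open>Every quandle in play must have its carrier inside the one type \<open>'u\<close>, and
  this shapes the constructions. Centrality quantifies over bases \<open>E\<close> on
  \<open>'u\<close>, whereas transports involve functions and live on another type. For a covering,
  a translation depends only on a point of the base, so a transport is named by a finite word over
  \<open>'u\<close>. An infinite type contains copies of its own lists and pairs: lists house the
  trivializing quandle, pairs the kernel pair.

  Orbits of \<open>Inn_group\<close> are treated as reachability classes of single translations.
  Triviality of an extension then becomes a statement open to induction: distinct points of one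
  component have distinct images.\<close>

lemma cat_id: "is_category C \<Longrightarrow> X \<in> Obj C \<Longrightarrow> Id C X \<in> Hom C X X"
  by (simp add: is_category_def)

lemma cat_comp:
  "is_category C \<Longrightarrow> f \<in> Hom C X Y \<Longrightarrow> g \<in> Hom C Y Z \<Longrightarrow> X \<in> Obj C \<Longrightarrow> Y \<in> Obj C \<Longrightarrow> Z \<in> Obj C
    \<Longrightarrow> Comp C X Y Z g f \<in> Hom C X Z"
  unfolding is_category_def by blast

lemma cat_id_right:
  "is_category C \<Longrightarrow> f \<in> Hom C X Y \<Longrightarrow> X \<in> Obj C \<Longrightarrow> Y \<in> Obj C \<Longrightarrow> Comp C X X Y f (Id C X) = f"
  unfolding is_category_def by blast

lemma cat_id_left:
  "is_category C \<Longrightarrow> f \<in> Hom C X Y \<Longrightarrow> X \<in> Obj C \<Longrightarrow> Y \<in> Obj C \<Longrightarrow> Comp C X Y Y (Id C Y) f = f"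
  unfolding is_category_def by blast

lemma cat_assoc:
  "is_category C \<Longrightarrow> f \<in> Hom C W X \<Longrightarrow> g \<in> Hom C X Y \<Longrightarrow> h \<in> Hom C Y Z
    \<Longrightarrow> W \<in> Obj C \<Longrightarrow> X \<in> Obj C \<Longrightarrow> Y \<in> Obj C \<Longrightarrow> Z \<in> Obj C
    \<Longrightarrow> Comp C W Y Z h (Comp C W X Y g f) = Comp C W X Z (Comp C X Y Z h g) f"
  unfolding is_category_def by blast

lemma Obj_full_subcategory [simp]: "Obj (full_subcategory C P) = {X \<in> Obj C. P X}"
  and Hom_full_subcategory [simp]: "Hom (full_subcategory C P) = Hom C"
  and Id_full_subcategory [simp]: "Id (full_subcategory C P) = Id C"
  and Comp_full_subcategory [simp]: "Comp (full_subcategory C P) = Comp C"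
  by (simp_all add: full_subcategory_def)

lemma is_category_full_subcategory: "is_category C \<Longrightarrow> is_category (full_subcategory C P)"
  by (simp add: is_category_def)

lemma is_category_arrow_category:
  assumes C: "is_category C"
  shows "is_category (arrow_category C)"
  unfolding is_category_def
proof (intro conjI)
  show "\<forall>X\<in>Obj (arrow_category C). Id (arrow_category C) X \<in> Hom (arrow_category C) X X"
    using C by (auto simp: arrow_category_def cat_id cat_id_left cat_id_right)
  show "\<forall>X\<in>Obj (arrow_category C). \<forall>Y\<in>Obj (arrow_category C). \<forall>f\<in>Hom (arrow_category C) X Y.
      Comp (arrow_category C) X X Y f (Id (arrow_category C) X) = f \<and>
      Comp (arrow_category C) X Y Y (Id (arrow_category C) Y) f = f"
    using C by (auto simp: arrow_category_def cat_id_left cat_id_right)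
  show "\<forall>W\<in>Obj (arrow_category C). \<forall>X\<in>Obj (arrow_category C). \<forall>Y\<in>Obj (arrow_category C).
      \<forall>Z\<in>Obj (arrow_category C). \<forall>f\<in>Hom (arrow_category C) W X.
      \<forall>g\<in>Hom (arrow_category C) X Y. \<forall>h\<in>Hom (arrow_category C) Y Z.
        Comp (arrow_category C) W Y Z h (Comp (arrow_category C) W X Y g f) =
        Comp (arrow_category C) W X Z (Comp (arrow_category C) X Y Z h g) f"
    using C by (auto simp: arrow_category_def cat_assoc)
  \<comment> \<open>Pasting of two commuting squares: associativity moves \<open>g\<close> from one
    square to the other.\<close>
  have square: "Comp C A B B'' (Comp C B B' B'' \<beta>\<^sub>0 \<alpha>\<^sub>0) f = Comp C A A'' B'' h (Comp C A A' A'' \<beta>\<^sub>1 \<alpha>\<^sub>1)"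
    if o: "A \<in> Obj C" "A' \<in> Obj C" "A'' \<in> Obj C" "B \<in> Obj C" "B' \<in> Obj C" "B'' \<in> Obj C"
      and m: "f \<in> Hom C A B" "g \<in> Hom C A' B'" "h \<in> Hom C A'' B''"
        "\<alpha>\<^sub>1 \<in> Hom C A A'" "\<alpha>\<^sub>0 \<in> Hom C B B'" "\<beta>\<^sub>1 \<in> Hom C A' A''" "\<beta>\<^sub>0 \<in> Hom C B' B''"
      and eq: "Comp C A B B' \<alpha>\<^sub>0 f = Comp C A A' B' g \<alpha>\<^sub>1"
        "Comp C A' B' B'' \<beta>\<^sub>0 g = Comp C A' A'' B'' h \<beta>\<^sub>1"
    for A A' A'' B B' B'' f g h \<alpha>\<^sub>1 \<alpha>\<^sub>0 \<beta>\<^sub>1 \<beta>\<^sub>0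
  proof -
    have square: "Comp C A B B'' (Comp C B B' B'' \<beta>\<^sub>0 \<alpha>\<^sub>0) f = Comp C A B' B'' \<beta>\<^sub>0 (Comp C A A' B' g \<alpha>\<^sub>1)"
      using cat_assoc[OF C m(1) m(5) m(7)] o eq by simp
    also have "\<dots> = Comp C A A' B'' (Comp C A' A'' B'' h \<beta>\<^sub>1) \<alpha>\<^sub>1"
      using cat_assoc[OF C m(4) m(2) m(7)] o eq by simp
    also have "\<dots> = Comp C A A'' B'' h (Comp C A A' A'' \<beta>\<^sub>1 \<alpha>\<^sub>1)"
      using cat_assoc[OF C m(4) m(6) m(3)] o by simp
    finally show ?thesis .
  qed
  show "\<forall>X\<in>Obj (arrow_category C). \<forall>Y\<in>Obj (arrow_category C). \<forall>Z\<in>Obj (arrow_category C).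
      \<forall>f\<in>Hom (arrow_category C) X Y. \<forall>g\<in>Hom (arrow_category C) Y Z.
        Comp (arrow_category C) X Y Z g f \<in> Hom (arrow_category C) X Z"
    by (clarsimp simp: arrow_category_def cat_comp[OF C]) (rule square)
qed

section \<open>Universal arrows into a full subcategory and adjunctions\<close>

definition reflection_arrow ::
    "('o, 'm) category \<Rightarrow> ('o, 'm) category \<Rightarrow> 'o \<Rightarrow> 'o \<Rightarrow> 'm \<Rightarrow> bool" where
  "reflection_arrow C D X Y r \<longleftrightarrow> Y \<in> Obj D \<and> r \<in> Hom C X Y \<and>
     (\<forall>Z\<in>Obj D. \<forall>h\<in>Hom C X Z. \<exists>!k. k \<in> Hom C Y Z \<and> Comp C X Y Z k r = h)"

text \<open>Right cancellation of a universal arrow. The last premise stands in for closure under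
  composition, since \<open>reflection_arrow\<close> does not say that \<open>C\<close> is a
  category.\<close>

lemma reflection_arrow_unique:
  "reflection_arrow C D X Y r \<Longrightarrow> Z \<in> Obj D \<Longrightarrow> k \<in> Hom C Y Z \<Longrightarrow> k' \<in> Hom C Y Z
    \<Longrightarrow> Comp C X Y Z k r = Comp C X Y Z k' r \<Longrightarrow> Comp C X Y Z k r \<in> Hom C X Z \<Longrightarrow> k = k'"
  unfolding reflection_arrow_def by metis

text \<open>An arrow from \<open>R X\<close> into an object of \<open>D\<close> is determined by its
  composite with \<open>r X\<close>. Thus \<open>fmap\<close> is the factorization of
  \<open>r Y\<close> after \<open>f\<close>, and functoriality, naturality of the counit and the
  triangle identity at \<open>R X\<close> hold because both sides agree after \<open>r X\<close>.
  The other triangle identity and naturality of the unit are the defining equations.\<close>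

lemma adjunction_of_reflections:
  assumes C: "is_category C" and D_def: "D = full_subcategory C P"
    and refl: "\<And>X. X \<in> Obj C \<Longrightarrow> reflection_arrow C D X (R X) (r X)"
  shows "\<exists>F \<epsilon>. adjunction C D F inclusion_functor r \<epsilon>"
proof -
  have D: "is_category D" "Obj D \<subseteq> Obj C" "Hom D = Hom C" "Id D = Id C" "Comp D = Comp C"
    using is_category_full_subcategory[OF C] by (auto simp: D_def)
  have RD: "R X \<in> Obj D" and r: "r X \<in> Hom C X (R X)" if "X \<in> Obj C" for X
    using refl[OF that] unfolding reflection_arrow_def by blast+
  have RC: "R X \<in> Obj C" if "X \<in> Obj C" for X
    using RD[OF that] D(2) by blast
  have uniq: "k = k'"
    if "X \<in> Obj C" "Z \<in> Obj D" "k \<in> Hom C (R X) Z" "k' \<in> Hom C (R X) Z"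
      "Comp C X (R X) Z k (r X) = Comp C X (R X) Z k' (r X)" for X Z k k'
  proof (rule reflection_arrow_unique[OF refl[OF that(1)] that(2-5)])
    show "Comp C X (R X) Z k (r X) \<in> Hom C X Z"
      using that(2) D(2) by (intro cat_comp[OF C r that(3)] that(1) RC) auto
  qed
  define lift where
    "lift X Z h = (THE k. k \<in> Hom C (R X) Z \<and> Comp C X (R X) Z k (r X) = h)" for X Z h
  have lift: "lift X Z h \<in> Hom C (R X) Z" "Comp C X (R X) Z (lift X Z h) (r X) = h"
    if "X \<in> Obj C" "Z \<in> Obj D" "h \<in> Hom C X Z" for X Z h
  proof -
    have "\<exists>!k. k \<in> Hom C (R X) Z \<and> Comp C X (R X) Z k (r X) = h"
      using refl[OF that(1)] that by (auto simp: reflection_arrow_def)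
    from theI'[OF this] show "lift X Z h \<in> Hom C (R X) Z" "Comp C X (R X) Z (lift X Z h) (r X) = h"
      by (auto simp: lift_def)
  qed
  define F where "F = \<lparr>fobj = R, fmap = (\<lambda>X Y f. lift X (R Y) (Comp C X Y (R Y) (r Y) f))\<rparr>"
  \<comment> \<open>The counit is the factorization of the identity of \<open>Y\<close> through
    \<open>r Y\<close>.\<close>
  define \<epsilon> where "\<epsilon> = (\<lambda>Y. lift Y Y (Id C Y))"
  have Ff: "fmap F X Y f \<in> Hom C (R X) (R Y)"
      "Comp C X (R X) (R Y) (fmap F X Y f) (r X) = Comp C X Y (R Y) (r Y) f"
    if "X \<in> Obj C" "Y \<in> Obj C" "f \<in> Hom C X Y" for X Y f
    using lift[of X "R Y" "Comp C X Y (R Y) (r Y) f"] that RD RC r cat_comp[OF C]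
    by (auto simp: F_def)
  have F: "is_functor C D F"
    unfolding is_functor_def
  proof (intro conjI ballI)
    fix X assume X: "X \<in> Obj C"
    show "fmap F X X (Id C X) = Id D (fobj F X)"
      using X uniq[of X "R X" "fmap F X X (Id C X)" "Id C (R X)"] Ff[OF X X cat_id[OF C X]]
      by (simp add: F_def D RD RC r cat_id[OF C] cat_id_left[OF C] cat_id_right[OF C])
  next
    fix X Y Z f g assume X: "X \<in> Obj C" "Y \<in> Obj C" "Z \<in> Obj C" "f \<in> Hom C X Y" "g \<in> Hom C Y Z"
    let ?f = "fmap F X Y f" and ?g = "fmap F Y Z g"
    have gf: "Comp C X Y Z g f \<in> Hom C X Z" using X cat_comp[OF C] by blast
    have "Comp C X (R X) (R Z) (Comp C (R X) (R Y) (R Z) ?g ?f) (r X)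
        = Comp C X (R Y) (R Z) ?g (Comp C X (R X) (R Y) ?f (r X))"
      using cat_assoc[OF C r[OF X(1)] Ff(1)[OF X(1,2,4)] Ff(1)[OF X(2,3,5)]] X RC by simp
    also have "\<dots> = Comp C X Y (R Z) (Comp C Y (R Y) (R Z) ?g (r Y)) f"
      using cat_assoc[OF C X(4) r[OF X(2)] Ff(1)[OF X(2,3,5)]] X RC by (simp add: Ff)
    also have "\<dots> = Comp C X Z (R Z) (r Z) (Comp C X Y Z g f)"
      using cat_assoc[OF C X(4,5) r[OF X(3)]] X RC by (simp add: Ff)
    finally have eq: "Comp C X (R X) (R Z) (Comp C (R X) (R Y) (R Z) ?g ?f) (r X)
        = Comp C X Z (R Z) (r Z) (Comp C X Y Z g f)" .
    have "Comp C (R X) (R Y) (R Z) ?g ?f = fmap F X Z (Comp C X Y Z g f)"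
      by (rule uniq[of X "R Z"]) (use eq X gf RD RC Ff cat_comp[OF C Ff(1) Ff(1)] in simp_all)
    then show "fmap F X Z (Comp C X Y Z g f) = Comp D (fobj F X) (fobj F Y) (fobj F Z) ?g ?f"
      by (simp add: D F_def)
  qed (use Ff RD C D in \<open>auto simp: F_def\<close>)
  have G: "is_functor D C inclusion_functor" "is_functor C C id_functor" "is_functor D D id_functor"
    using C D by (auto simp: is_functor_def id_functor_def)
  have GF: "is_functor C C (comp_functor id_functor F)" "is_functor D D (comp_functor F id_functor)"
    using F C D by (auto simp: is_functor_def id_functor_def comp_functor_def subset_iff)
  have \<epsilon>: "\<epsilon> Y \<in> Hom C (R Y) Y" "Comp C Y (R Y) Y (\<epsilon> Y) (r Y) = Id C Y" if "Y \<in> Obj D" for Y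
    using lift[of Y Y "Id C Y"] that D(2) cat_id[OF C] by (auto simp: \<epsilon>_def)
  have fobjF: "fobj F = R" by (simp add: F_def)
  have "natural_transformation C C id_functor (comp_functor id_functor F) r"
    using G GF r Ff by (auto simp: natural_transformation_def id_functor_def comp_functor_def fobjF)
  moreover have "natural_transformation D D (comp_functor F id_functor) id_functor \<epsilon>"
    unfolding natural_transformation_def
  proof (intro conjI ballI G GF)
    fix X Y f assume X: "X \<in> Obj D" "Y \<in> Obj D" "f \<in> Hom D X Y"
    have XC: "X \<in> Obj C" "Y \<in> Obj C" "f \<in> Hom C X Y" using X D by auto
    have "Comp C X (R X) Y (Comp C (R X) (R Y) Y (\<epsilon> Y) (fmap F X Y f)) (r X)
        = Comp C X (R Y) Y (\<epsilon> Y) (Comp C X Y (R Y) (r Y) f)"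
      using cat_assoc[OF C r[OF XC(1)] Ff(1)[OF XC] \<epsilon>(1)[OF X(2)]] XC RC by (simp add: Ff)
    also have "\<dots> = f"
      using cat_assoc[OF C XC(3) r[OF XC(2)] \<epsilon>(1)[OF X(2)]] XC RC
      by (simp add: \<epsilon> X cat_id_left[OF C])
    also have "f = Comp C X (R X) Y (Comp C (R X) X Y f (\<epsilon> X)) (r X)"
      using cat_assoc[OF C r[OF XC(1)] \<epsilon>(1)[OF X(1)] XC(3)] XC RC
      by (simp add: \<epsilon> X cat_id_right[OF C])
    finally have eq: "Comp C X (R X) Y (Comp C (R X) (R Y) Y (\<epsilon> Y) (fmap F X Y f)) (r X)
        = Comp C X (R X) Y (Comp C (R X) X Y f (\<epsilon> X)) (r X)" .
    have "Comp C (R X) (R Y) Y (\<epsilon> Y) (fmap F X Y f) = Comp C (R X) X Y f (\<epsilon> X)"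
      by (rule uniq[of X Y])
        (use eq X XC RC RD cat_comp[OF C Ff(1) \<epsilon>(1)] cat_comp[OF C \<epsilon>(1) XC(3)] in simp_all)
    then show "Comp D (fobj (comp_functor F id_functor) X) (fobj (comp_functor F id_functor) Y)
        (fobj id_functor Y) (\<epsilon> Y) (fmap (comp_functor F id_functor) X Y f) =
      Comp D (fobj (comp_functor F id_functor) X) (fobj id_functor X) (fobj id_functor Y)
        (fmap id_functor X Y f) (\<epsilon> X)"
      by (simp add: D id_functor_def comp_functor_def fobjF)
  qed (use \<epsilon> in \<open>auto simp: D id_functor_def comp_functor_def fobjF\<close>)
  moreover have "Comp C (R X) (R (R X)) (R X) (\<epsilon> (R X)) (fmap F X (R X) (r X)) = Id C (R X)"
    if X: "X \<in> Obj C" for X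
  proof (rule uniq[of X "R X"])
    note f = Ff[OF X RC[OF X] r[OF X]] and e = \<epsilon>[OF RD[OF X]] and rr = r[OF RC[OF X]]
    have "Comp C X (R X) (R X) (Comp C (R X) (R (R X)) (R X) (\<epsilon> (R X)) (fmap F X (R X) (r X))) (r X)
       = Comp C X (R (R X)) (R X) (\<epsilon> (R X)) (Comp C X (R X) (R (R X)) (r (R X)) (r X))"
      using cat_assoc[OF C r[OF X] f(1) e(1)] X RC by (simp add: f)
    also have "\<dots> = r X"
      using cat_assoc[OF C r[OF X] rr e(1)] X RC by (simp add: e cat_id_left[OF C] r)
    finally show "Comp C X (R X) (R X)
        (Comp C (R X) (R (R X)) (R X) (\<epsilon> (R X)) (fmap F X (R X) (r X))) (r X)
      = Comp C X (R X) (R X) (Id C (R X)) (r X)"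
      using X RC by (simp add: cat_id_left[OF C] r)
    show "Comp C (R X) (R (R X)) (R X) (\<epsilon> (R X)) (fmap F X (R X) (r X)) \<in> Hom C (R X) (R X)"
      using X RC f e by (intro cat_comp[OF C]) auto
  qed (use X RC RD cat_id[OF C] in auto)
  ultimately show ?thesis
    using F G \<epsilon> by (auto simp: adjunction_def fobjF D id_functor_def intro!: exI[of _ F] exI[of _ \<epsilon>])
qed

text \<open>The usual bijection of hom-sets, read off from unit and counit. Existence uses the
  triangle identity at \<open>Z\<close>, uniqueness the one at \<open>X\<close>.\<close>

lemma adjunction_unit_reflection_arrow:
  assumes C: "is_category C" and D_def: "D = full_subcategory C P"
    and adj: "adjunction C D F inclusion_functor \<eta> \<epsilon>" and X: "X \<in> Obj C"
  shows "reflection_arrow C D X (fobj F X) (\<eta> X)"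
proof -
  have D: "Obj D \<subseteq> Obj C" "Hom D = Hom C" "Id D = Id C" "Comp D = Comp C"
    by (auto simp: D_def)
  have F: "fobj F Y \<in> Obj D" "fobj F Y \<in> Obj C" if "Y \<in> Obj C" for Y
    using adj that D by (auto simp: adjunction_def is_functor_def)
  have Ff: "fmap F Y Z f \<in> Hom C (fobj F Y) (fobj F Z)"
    if "Y \<in> Obj C" "Z \<in> Obj C" "f \<in> Hom C Y Z" for Y Z f
    using adj that D by (auto simp: adjunction_def is_functor_def)
  have Fcomp: "fmap F Y W (Comp C Y Z W g f)
      = Comp C (fobj F Y) (fobj F Z) (fobj F W) (fmap F Z W g) (fmap F Y Z f)"
    if "Y \<in> Obj C" "Z \<in> Obj C" "W \<in> Obj C" "f \<in> Hom C Y Z" "g \<in> Hom C Z W" for Y Z W f g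
    using adj that D by (simp add: adjunction_def is_functor_def)
  have \<eta>: "\<eta> Y \<in> Hom C Y (fobj F Y)" if "Y \<in> Obj C" for Y
    using adj that
    by (auto simp: adjunction_def natural_transformation_def id_functor_def comp_functor_def)
  have \<eta>_nat: "Comp C Y Z (fobj F Z) (\<eta> Z) f = Comp C Y (fobj F Y) (fobj F Z) (fmap F Y Z f) (\<eta> Y)"
    if "Y \<in> Obj C" "Z \<in> Obj C" "f \<in> Hom C Y Z" for Y Z f
    using adj that
    by (auto simp: adjunction_def natural_transformation_def id_functor_def comp_functor_def)
  have \<epsilon>: "\<epsilon> Y \<in> Hom C (fobj F Y) Y" if "Y \<in> Obj D" for Y
    using adj that D
    by (auto simp: adjunction_def natural_transformation_def id_functor_def comp_functor_def)
  have \<epsilon>_nat: "Comp C (fobj F Y) (fobj F Z) Z (\<epsilon> Z) (fmap F Y Z f) = Comp C (fobj F Y) Y Z f (\<epsilon> Y)"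
    if "Y \<in> Obj D" "Z \<in> Obj D" "f \<in> Hom C Y Z" for Y Z f
    using adj that D
    by (auto simp: adjunction_def natural_transformation_def id_functor_def comp_functor_def)
  have tri1: "Comp C (fobj F X) (fobj F (fobj F X)) (fobj F X) (\<epsilon> (fobj F X))
      (fmap F X (fobj F X) (\<eta> X)) = Id C (fobj F X)"
    using adj X D by (auto simp: adjunction_def id_functor_def)
  have tri2: "Comp C Y (fobj F Y) Y (\<epsilon> Y) (\<eta> Y) = Id C Y" if "Y \<in> Obj D" for Y
    using adj that D by (auto simp: adjunction_def id_functor_def)
  have "\<exists>!k. k \<in> Hom C (fobj F X) Z \<and> Comp C X (fobj F X) Z k (\<eta> X) = h"
    if Z: "Z \<in> Obj D" and h: "h \<in> Hom C X Z" for Z h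
  proof (rule ex1I)
    have ZC: "Z \<in> Obj C" using Z D by auto
    \<comment> \<open>The adjoint transpose of \<open>h\<close>.\<close>
    let ?k = "Comp C (fobj F X) (fobj F Z) Z (\<epsilon> Z) (fmap F X Z h)"
    have "Comp C X (fobj F X) Z ?k (\<eta> X) = Comp C X (fobj F Z) Z (\<epsilon> Z) (Comp C X Z (fobj F Z) (\<eta> Z) h)"
      using cat_assoc[OF C \<eta>[OF X] Ff[OF X ZC h] \<epsilon>[OF Z]] X F ZC h by (simp add: \<eta>_nat)
    also have "\<dots> = h"
      using cat_assoc[OF C h \<eta>[OF ZC] \<epsilon>[OF Z]] X F ZC h by (simp add: tri2 Z cat_id_left[OF C])
    finally show "?k \<in> Hom C (fobj F X) Z \<and> Comp C X (fobj F X) Z ?k (\<eta> X) = h"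
      using cat_comp[OF C Ff[OF X ZC h] \<epsilon>[OF Z]] X F ZC by simp
    fix k assume k: "k \<in> Hom C (fobj F X) Z \<and> Comp C X (fobj F X) Z k (\<eta> X) = h"
    then have "fmap F X Z h = Comp C (fobj F X) (fobj F (fobj F X)) (fobj F Z)
        (fmap F (fobj F X) Z k) (fmap F X (fobj F X) (\<eta> X))"
      using Fcomp[of X "fobj F X" Z "\<eta> X" k] X F ZC \<eta> by simp
    then have "?k = Comp C (fobj F X) (fobj F (fobj F X)) Z
        (Comp C (fobj F (fobj F X)) (fobj F Z) Z (\<epsilon> Z) (fmap F (fobj F X) Z k))
        (fmap F X (fobj F X) (\<eta> X))"
      using cat_assoc[OF C Ff[OF X F(2)[OF X] \<eta>[OF X]] Ff[of "fobj F X" Z k] \<epsilon>[OF Z]] X F ZC k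
      by simp
    also have "\<dots> = Comp C (fobj F X) (fobj F X) Z k (Id C (fobj F X))"
      using cat_assoc[OF C Ff[OF X F(2)[OF X] \<eta>[OF X]] \<epsilon>[OF F(1)[OF X]], of k Z] X F ZC Z k
      by (simp add: \<epsilon>_nat tri1)
    also have "\<dots> = k"
      using cat_id_right[OF C] k X F ZC by blast
    finally show "k = ?k" ..
  qed
  then show ?thesis
    using X F \<eta> by (auto simp: reflection_arrow_def)
qed

section \<open>Invariance of regular epimorphisms under isomorphism\<close>

lemma is_coequalizer_comp_iso:
  assumes C: "is_category C" and coeq: "is_coequalizer C K X u v Y e"
    and Y': "Y' \<in> Obj C" and l: "l \<in> Hom C Y Y'" and m: "m \<in> Hom C Y' Y"
    and ml: "Comp C Y Y' Y m l = Id C Y" and lm: "Comp C Y' Y Y' l m = Id C Y'"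
  shows "is_coequalizer C K X u v Y' (Comp C X Y Y' l e)"
proof -
  have o: "K \<in> Obj C" "X \<in> Obj C" "Y \<in> Obj C" and u: "u \<in> Hom C K X" and v: "v \<in> Hom C K X"
    and e: "e \<in> Hom C X Y" and eq: "Comp C K X Y e u = Comp C K X Y e v"
    using coeq by (auto simp: is_coequalizer_def)
  have le: "Comp C X Y Y' l e \<in> Hom C X Y'"
    using cat_comp[OF C e l] o Y' by simp
  have "Comp C K X Y' (Comp C X Y Y' l e) u = Comp C K X Y' (Comp C X Y Y' l e) v"
    using cat_assoc[OF C u e l] cat_assoc[OF C v e l] eq o Y' by simp
  moreover have "\<exists>!k. k \<in> Hom C Y' Z \<and> Comp C X Y' Z k (Comp C X Y Y' l e) = h"
    if Z: "Z \<in> Obj C" and h: "h \<in> Hom C X Z" "Comp C K X Z h u = Comp C K X Z h v" for Z h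
  proof -
    have "\<exists>!k. k \<in> Hom C Y Z \<and> Comp C X Y Z k e = h"
      using coeq that by (auto simp: is_coequalizer_def)
    then obtain k where k: "k \<in> Hom C Y Z" "Comp C X Y Z k e = h"
      and uniq: "\<And>k'. k' \<in> Hom C Y Z \<Longrightarrow> Comp C X Y Z k' e = h \<Longrightarrow> k' = k"
      by blast
    show ?thesis
    \<comment> \<open>The factorization through \<open>Y\<close> is precomposed with the inverse
      \<open>m\<close> of \<open>l\<close>.\<close>
    proof (rule ex1I[of _ "Comp C Y' Y Z k m"], rule conjI)
      show "Comp C Y' Y Z k m \<in> Hom C Y' Z"
        using cat_comp[OF C m k(1)] o Y' Z by simp
      then have "Comp C X Y' Z (Comp C Y' Y Z k m) (Comp C X Y Y' l e)
          = Comp C X Y Z (Comp C Y Y' Z (Comp C Y' Y Z k m) l) e"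
        using cat_assoc[OF C e l] o Y' Z by simp
      also have "Comp C Y Y' Z (Comp C Y' Y Z k m) l = k"
        using cat_assoc[OF C l m k(1)] o Y' Z k by (simp add: ml cat_id_right[OF C])
      finally show "Comp C X Y' Z (Comp C Y' Y Z k m) (Comp C X Y Y' l e) = h"
        using k by simp
    next
      fix k' assume k': "k' \<in> Hom C Y' Z \<and> Comp C X Y' Z k' (Comp C X Y Y' l e) = h"
      then have "Comp C Y Y' Z k' l = k"
        using cat_assoc[OF C e l, of k' Z] cat_comp[OF C l, of k' Z] o Y' Z by (intro uniq) auto
      then have "Comp C Y' Y Z k m = Comp C Y' Y' Z k' (Comp C Y' Y Y' l m)"
        using cat_assoc[OF C m l, of k' Z] k' o Y' Z by simp
      then show "k' = Comp C Y' Y Z k m"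
        using k' Y' Z by (simp add: lm cat_id_right[OF C])
    qed
  qed
  ultimately show ?thesis
    using o u v le Y' by (auto simp: is_coequalizer_def)
qed

text \<open>Two universal arrows from \<open>X\<close> factor through each other by \<open>l\<close>
  and \<open>m\<close>. Both composites of \<open>l\<close> and \<open>m\<close> agree with an
  identity after a universal arrow, so they are identities, and \<open>s\<close> is \<open>r\<close>
  followed by an isomorphism.\<close>

lemma regular_epi_reflection_arrow_cong:
  assumes C: "is_category C" and D: "Obj D \<subseteq> Obj C" and X: "X \<in> Obj C"
    and r: "reflection_arrow C D X Y r" and s: "reflection_arrow C D X Y' s"
    and reg: "regular_epi C X Y r"
  shows "regular_epi C X Y' s"
proof -
  have Y: "Y \<in> Obj D" "Y \<in> Obj C" "Y' \<in> Obj D" "Y' \<in> Obj C"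
    and rh: "r \<in> Hom C X Y" and sh: "s \<in> Hom C X Y'"
    using r s D by (auto simp: reflection_arrow_def)
  obtain l where l: "l \<in> Hom C Y Y'" "Comp C X Y Y' l r = s"
    using r Y sh unfolding reflection_arrow_def by metis
  obtain m where m: "m \<in> Hom C Y' Y" "Comp C X Y' Y m s = r"
    using s Y rh unfolding reflection_arrow_def by metis
  have rr: "Comp C X Y Y (Comp C Y Y' Y m l) r = r"
    using cat_assoc[OF C rh l(1) m(1)] l m X Y by simp
  have ml: "Comp C Y Y' Y m l = Id C Y"
    using reflection_arrow_unique[OF r Y(1) cat_comp[OF C l(1) m(1)] cat_id[OF C]] rr rh X Y
      cat_id_left[OF C rh]
    by simp
  have ss: "Comp C X Y' Y' (Comp C Y' Y Y' l m) s = s"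
    using cat_assoc[OF C sh m(1) l(1)] l m X Y by simp
  have lm: "Comp C Y' Y Y' l m = Id C Y'"
    using reflection_arrow_unique[OF s Y(3) cat_comp[OF C m(1) l(1)] cat_id[OF C]] ss sh X Y
      cat_id_left[OF C sh]
    by simp
  show ?thesis
    using reg is_coequalizer_comp_iso[OF C _ Y(4) l(1) m(1) ml lm] l(2)
    unfolding regular_epi_def by metis
qed

section \<open>Quandles and trivial extensions\<close>

context quandle
begin

lemma op_eq_iff:
  "\<lbrakk>a \<in> carrier A; b \<in> carrier A; c \<in> carrier A\<rbrakk> \<Longrightarrow> a \<triangleleft> b = c \<longleftrightarrow> a = c \<triangleleft>\<inverse> b"
  using op_inv inv_op by auto

text \<open>Together with \<open>self_distrib\<close> and the two variants that follow, this makes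
  translations and their inverses compatible with both operations. Each variant is an earlier law
  with a translation cancelled.\<close>

lemma inv_op_distrib:
  assumes "a \<in> carrier A" "b \<in> carrier A" "c \<in> carrier A"
  shows "(a \<triangleleft>\<inverse> b) \<triangleleft> c = (a \<triangleleft> c) \<triangleleft>\<inverse> (b \<triangleleft> c)"
proof -
  have "((a \<triangleleft>\<inverse> b) \<triangleleft> c) \<triangleleft> (b \<triangleleft> c) = a \<triangleleft> c"
    using assms self_distrib[of "a \<triangleleft>\<inverse> b" b c] by (simp add: inv_closed inv_op)
  then show ?thesis
    using assms op_eq_iff by (simp add: op_closed inv_closed)
qed

lemma op_inv_distrib:
  assumes "a \<in> carrier A" "b \<in> carrier A" "c \<in> carrier A"
  shows "(a \<triangleleft> b) \<triangleleft>\<inverse> c = (a \<triangleleft>\<inverse> c) \<triangleleft> (b \<triangleleft>\<inverse> c)"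
  using assms self_distrib[of "a \<triangleleft>\<inverse> c" "b \<triangleleft>\<inverse> c" c] op_eq_iff
  by (simp add: op_closed inv_closed inv_op)

lemma inv_inv_distrib:
  assumes "a \<in> carrier A" "b \<in> carrier A" "c \<in> carrier A"
  shows "(a \<triangleleft>\<inverse> b) \<triangleleft>\<inverse> c = (a \<triangleleft>\<inverse> c) \<triangleleft>\<inverse> (b \<triangleleft>\<inverse> c)"
  using assms inv_op_distrib[of "a \<triangleleft>\<inverse> c" "b \<triangleleft>\<inverse> c" c] op_eq_iff
  by (simp add: inv_closed inv_op)

end

lemma quandle_homI:
  assumes "f \<in> extensional (carrier A)"
    and "\<And>a. a \<in> carrier A \<Longrightarrow> f a \<in> carrier B"
    and "\<And>a a'. a \<in> carrier A \<Longrightarrow> a' \<in> carrier A \<Longrightarrow> f (a \<triangleleft>\<^bsub>A\<^esub> a') = f a \<triangleleft>\<^bsub>B\<^esub> f a'"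
    and "\<And>a a'. a \<in> carrier A \<Longrightarrow> a' \<in> carrier A \<Longrightarrow> f (a \<triangleleft>\<inverse>\<^bsub>A\<^esub> a') = f a \<triangleleft>\<inverse>\<^bsub>B\<^esub> f a'"
  shows "f \<in> quandle_hom A B"
  using assms by (auto simp: quandle_hom_def PiE_def)

lemma
  assumes "f \<in> quandle_hom A B"
  shows hom_closed: "a \<in> carrier A \<Longrightarrow> f a \<in> carrier B"
    and hom_op: "a \<in> carrier A \<Longrightarrow> a' \<in> carrier A \<Longrightarrow> f (a \<triangleleft>\<^bsub>A\<^esub> a') = f a \<triangleleft>\<^bsub>B\<^esub> f a'"
    and hom_inv: "a \<in> carrier A \<Longrightarrow> a' \<in> carrier A \<Longrightarrow> f (a \<triangleleft>\<inverse>\<^bsub>A\<^esub> a') = f a \<triangleleft>\<inverse>\<^bsub>B\<^esub> f a'"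
    and hom_extensional: "f \<in> extensional (carrier A)"
  using assms by (auto simp: quandle_hom_def PiE_def)

lemma hom_restrict: "f \<in> quandle_hom A B \<Longrightarrow> restrict f (carrier A) = f"
  by (simp add: hom_extensional extensional_restrict)

lemma quandle_hom_compose:
  assumes "quandle A" "f \<in> quandle_hom A B" "g \<in> quandle_hom B C"
  shows "compose (carrier A) g f \<in> quandle_hom A C"
  using assms
  by (intro quandle_homI)
    (auto simp: compose_def quandle.op_closed quandle.inv_closed hom_closed hom_op hom_inv)

lemma quandle_hom_id: "quandle A \<Longrightarrow> (\<lambda>a\<in>carrier A. a) \<in> quandle_hom A A"
  by (intro quandle_homI) (auto simp: quandle.op_closed quandle.inv_closed)

section \<open>Orbits of inner automorphisms as reachability classes\<close>

definition inner_step :: "'a quandle \<Rightarrow> 'a rel" where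
  "inner_step A = {(a, a'). a \<in> carrier A \<and>
     (\<exists>b\<in>carrier A. a' = a \<triangleleft>\<^bsub>A\<^esub> b \<or> a' = a \<triangleleft>\<inverse>\<^bsub>A\<^esub> b)}"

text \<open>Stand-in for the \<open>Inn_group\<close> orbit of \<open>a\<close>: with one
  translation or inverse translation per step, claims about orbits are proved by induction along a
  path, without group elements.\<close>

definition component :: "'a quandle \<Rightarrow> 'a \<Rightarrow> 'a set" where
  "component A a = (inner_step A)\<^sup>* `` {a}"

lemma component_subset:
  assumes "quandle A" "a \<in> carrier A"
  shows "component A a \<subseteq> carrier A"
proof -
  have "a' \<in> carrier A" if "(a, a') \<in> (inner_step A)\<^sup>*" for a'
    using that assms
    by induction (auto simp: inner_step_def quandle.op_closed quandle.inv_closed)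
  then show ?thesis by (auto simp: component_def)
qed

lemma sym_inner_step:
  assumes "quandle A"
  shows "sym (inner_step A)"
  using assms by (intro symI) (auto simp: inner_step_def quandle.op_closed quandle.inv_closed
      quandle.op_inv quandle.inv_op; metis quandle.op_inv quandle.inv_op)+

lemma component_eqI: "quandle A \<Longrightarrow> b \<in> component A a \<Longrightarrow> component A b = component A a"
  using sym_rtrancl[OF sym_inner_step]
  by (auto simp: component_def dest: symD intro: rtrancl_trans)

lemma component_refl: "a \<in> component A a"
  by (simp add: component_def)

lemma component_op: "quandle A \<Longrightarrow> a \<in> carrier A \<Longrightarrow> b \<in> carrier A \<Longrightarrow> component A (a \<triangleleft>\<^bsub>A\<^esub> b) = component A a"
  by (rule component_eqI) (auto simp: component_def inner_step_def)

lemma component_inv: "quandle A \<Longrightarrow> a \<in> carrier A \<Longrightarrow> b \<in> carrier A \<Longrightarrow> component A (a \<triangleleft>\<inverse>\<^bsub>A\<^esub> b) = component A a"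
  by (rule component_eqI) (auto simp: component_def inner_step_def)

lemma quandle_iso_subset_Bij: "quandle_iso A A \<subseteq> Bij (carrier A)"
  by (auto simp: quandle_iso_def Bij_def hom_extensional)

lemma mult_Aut_group:
  "f \<in> quandle_iso A A \<Longrightarrow> g \<in> quandle_iso A A \<Longrightarrow> g \<otimes>\<^bsub>Aut_group A\<^esub> f = compose (carrier A) g f"
  using quandle_iso_subset_Bij[of A] by (auto simp: Aut_group_def BijGroup_def)

lemma quandle_iso_compose:
  "quandle A \<Longrightarrow> f \<in> quandle_iso A A \<Longrightarrow> g \<in> quandle_iso A A \<Longrightarrow> compose (carrier A) g f \<in> quandle_iso A A"
  unfolding quandle_iso_def by (auto intro: quandle_hom_compose bij_betw_compose)

text \<open>The generators of \<open>Inn_group\<close> and their group inverses in explicit form.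
  The inverse is computed from the definite description \<open>m_inv_def\<close>, so no group
  structure on \<open>Aut_group A\<close> has to be set up.\<close>

lemma translation_inverses:
  fixes A :: "'a quandle" (structure)
  assumes A: "quandle A" and b: "b \<in> carrier A"
  shows "right_translation A b \<in> quandle_iso A A" (is "?r \<in> _")
    and "inv\<^bsub>Aut_group A\<^esub> (right_translation A b) = (\<lambda>a\<in>carrier A. a \<triangleleft>\<inverse> b)" (is "_ = ?s")
    and "(\<lambda>a\<in>carrier A. a \<triangleleft>\<inverse> b) \<in> quandle_iso A A"
proof -
  interpret quandle A by (rule A)
  have bij: "bij_betw ?r (carrier A) (carrier A)" "bij_betw ?s (carrier A) (carrier A)"
    by (rule bij_betw_byWitness[of _ ?s] bij_betw_byWitness[of _ ?r];
        use b in \<open>auto simp: right_translation_def op_closed inv_closed op_inv inv_op\<close>)+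
  show r: "?r \<in> quandle_iso A A"
    using b bij unfolding quandle_iso_def
    by (auto intro!: quandle_homI simp: right_translation_def op_closed inv_closed
        self_distrib[OF _ _ b] inv_op_distrib[OF _ _ b])
  show s: "?s \<in> quandle_iso A A"
    using b bij unfolding quandle_iso_def
    by (auto intro!: quandle_homI simp: op_closed inv_closed
        op_inv_distrib[OF _ _ b] inv_inv_distrib[OF _ _ b])
  show "inv\<^bsub>Aut_group A\<^esub> ?r = ?s"
    unfolding m_inv_def
  proof (rule the_equality)
    have car: "carrier (Aut_group A) = quandle_iso A A" and one: "\<one>\<^bsub>Aut_group A\<^esub> = (\<lambda>a\<in>carrier A. a)"
      by (simp_all add: Aut_group_def BijGroup_def)
    show "?s \<in> carrier (Aut_group A) \<and> ?r \<otimes>\<^bsub>Aut_group A\<^esub> ?s = \<one>\<^bsub>Aut_group A\<^esub> \<and>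
        ?s \<otimes>\<^bsub>Aut_group A\<^esub> ?r = \<one>\<^bsub>Aut_group A\<^esub>"
      using b r s
      by (auto simp: car one mult_Aut_group compose_def right_translation_def
          op_closed inv_closed op_inv inv_op fun_eq_iff)
    fix y assume y: "y \<in> carrier (Aut_group A) \<and> ?r \<otimes>\<^bsub>Aut_group A\<^esub> y = \<one>\<^bsub>Aut_group A\<^esub> \<and>
        y \<otimes>\<^bsub>Aut_group A\<^esub> ?r = \<one>\<^bsub>Aut_group A\<^esub>"
    then have yiso: "y \<in> quandle_iso A A" and eq: "compose (carrier A) y ?r = (\<lambda>a\<in>carrier A. a)"
      using r by (auto simp: car one mult_Aut_group)
    show "y = ?s"
    proof (rule extensionalityI)
      show "y \<in> extensional (carrier A)"
        using yiso by (auto simp: quandle_iso_def hom_extensional)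
      fix a assume a: "a \<in> carrier A"
      then have "y (?r (a \<triangleleft>\<inverse> b)) = a \<triangleleft>\<inverse> b"
        using fun_cong[OF eq, of "a \<triangleleft>\<inverse> b"] b by (simp add: inv_closed compose_def)
      then show "y a = ?s a"
        using a b by (simp add: right_translation_def inv_closed inv_op)
    qed simp
  qed
qed

text \<open>Induction over \<open>generate\<close>. Being an automorphism is carried along because
  the product of \<open>BijGroup\<close> is known to be composition only on bijections of the
  carrier.\<close>

lemma Inn_group_mem:
  fixes A :: "'a quandle"
  assumes A: "quandle A" and "\<phi> \<in> carrier (Inn_group A)"
  shows "\<phi> \<in> quandle_iso A A \<and> (\<forall>a\<in>carrier A. \<phi> a \<in> component A a)"
proof -
  have "\<phi> \<in> generate (Aut_group A) (right_translation A ` carrier A)"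
    using assms by (simp add: Inn_group_def)
  then show ?thesis
  proof induction
    case one
    have "(\<lambda>a\<in>carrier A. a) \<in> quandle_iso A A"
      using quandle_hom_id[OF A] by (auto simp: quandle_iso_def bij_betw_def inj_on_def)
    moreover have "\<one>\<^bsub>Aut_group A\<^esub> = (\<lambda>a\<in>carrier A. a)"
      by (simp add: Aut_group_def BijGroup_def)
    ultimately show ?case
      by (simp only:) (simp add: component_refl)
  next
    case (incl h)
    then obtain b where b: "b \<in> carrier A" "h = right_translation A b" by blast
    then show ?case
      using translation_inverses(1)[OF A b(1)] component_op[OF A _ b(1)] component_refl
      by (metis right_translation_def restrict_apply')
  next
    case (inv h)
    then obtain b where b: "b \<in> carrier A" "h = right_translation A b" by blast
    then show ?case
      using translation_inverses(2,3)[OF A b(1)] component_inv[OF A _ b(1)] component_refl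
      by (metis restrict_apply')
  next
    case (eng h1 h2)
    then have "h1 \<otimes>\<^bsub>Aut_group A\<^esub> h2 = compose (carrier A) h1 h2"
      by (simp add: mult_Aut_group)
    moreover have "h1 (h2 a) \<in> component A a" if "a \<in> carrier A" for a
      using that eng component_subset[OF A] component_eqI[OF A] by blast
    ultimately show ?case
      using eng quandle_iso_compose[OF A] by (metis compose_eq)
  qed
qed

text \<open>Connects the group-theoretic orbit with reachability. For the inclusion into the orbit,
  a path is turned into a product of generators by multiplying on the left with one translation or
  its inverse per step.\<close>

lemma orbit_Inn_group:
  fixes A :: "'a quandle" (structure)
  assumes A: "quandle A" and a: "a \<in> carrier A"
  shows "orbit (Inn_group A) (\<lambda>\<phi>. \<phi>) a = component A a"
proof
  show "orbit (Inn_group A) (\<lambda>\<phi>. \<phi>) a \<subseteq> component A a"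
    using Inn_group_mem[OF A] a by (auto simp: orbit_def)
  have "\<exists>\<phi>\<in>carrier (Inn_group A). \<phi> a = a'" if "(a, a') \<in> (inner_step A)\<^sup>*" for a'
    using that
  proof induction
    case base
    have "\<one>\<^bsub>Aut_group A\<^esub> \<in> carrier (Inn_group A)"
      by (simp add: Inn_group_def generate.one)
    moreover have "\<one>\<^bsub>Aut_group A\<^esub> a = a"
      using a by (simp add: Aut_group_def BijGroup_def)
    ultimately show ?case by blast
  next
    case (step c d)
    then obtain \<phi> b where \<phi>: "\<phi> \<in> carrier (Inn_group A)" "\<phi> a = c"
      and b: "b \<in> carrier A" "d = c \<triangleleft> b \<or> d = c \<triangleleft>\<inverse> b" and c: "c \<in> carrier A"
      by (auto simp: inner_step_def)
    have "\<exists>\<psi>. \<psi> \<in> carrier (Inn_group A) \<and> \<psi> c = d"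
      using b c translation_inverses(2)[OF A b(1)]
        generate.incl[of "right_translation A b" "right_translation A ` carrier A" "Aut_group A"]
        generate.inv[of "right_translation A b" "right_translation A ` carrier A" "Aut_group A"]
      by (auto simp: Inn_group_def right_translation_def)
    then obtain \<psi> where \<psi>: "\<psi> \<in> carrier (Inn_group A)" "\<psi> c = d" by blast
    then have "\<psi> \<otimes>\<^bsub>Aut_group A\<^esub> \<phi> \<in> carrier (Inn_group A)"
      using \<phi> by (auto simp: Inn_group_def intro: generate.eng)
    moreover have "(\<psi> \<otimes>\<^bsub>Aut_group A\<^esub> \<phi>) a = d"
      using \<phi> \<psi> a Inn_group_mem[OF A] by (simp add: mult_Aut_group compose_def)
    ultimately show ?case by blast
  qed
  then show "component A a \<subseteq> orbit (Inn_group A) (\<lambda>\<phi>. \<phi>) a"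
    by (auto simp: component_def orbit_def)
qed

lemma carrier_pi0: "quandle A \<Longrightarrow> carrier (pi0 A) = component A ` carrier A"
  by (simp add: pi0_def orbits_def Setcompr_eq_image orbit_Inn_group cong: image_cong)

lemma qop_pi0 [simp]: "x \<triangleleft>\<^bsub>pi0 A\<^esub> y = x" and qinv_pi0 [simp]: "x \<triangleleft>\<inverse>\<^bsub>pi0 A\<^esub> y = x"
  by (simp_all add: pi0_def)

lemma pi0_unit_eq: "quandle A \<Longrightarrow> pi0_unit A = (\<lambda>a\<in>carrier A. component A a)"
  by (auto simp: pi0_unit_def orbit_Inn_group cong: restrict_cong)

lemma pi0_unit_hom: "quandle A \<Longrightarrow> pi0_unit A \<in> quandle_hom A (pi0 A)"
  by (rule quandle_homI)
    (auto simp: pi0_unit_eq carrier_pi0 quandle.op_closed quandle.inv_closed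
        component_op component_inv)

lemma hom_inner_step: "f \<in> quandle_hom A B \<Longrightarrow> (a, a') \<in> inner_step A \<Longrightarrow> (f a, f a') \<in> inner_step B"
  by (auto simp: inner_step_def hom_op hom_inv hom_closed)

lemma hom_component: "f \<in> quandle_hom A B \<Longrightarrow> a' \<in> component A a \<Longrightarrow> f a' \<in> component B (f a)"
proof -
  assume f: "f \<in> quandle_hom A B" and a': "a' \<in> component A a"
  from a' have "(a, a') \<in> (inner_step A)\<^sup>*" by (simp add: component_def)
  then have "(f a, f a') \<in> (inner_step B)\<^sup>*"
    by induction (auto dest: hom_inner_step[OF f])
  then show ?thesis by (simp add: component_def)
qed

section \<open>Trivial extensions\<close>

lemma extension_surj:
  assumes "extension A B f" "b \<in> carrier B"
  obtains a where "a \<in> carrier A" "f a = b"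
proof -
  have "b \<in> f ` carrier A" using assms by (simp add: extension_def)
  then show ?thesis using that by blast
qed

text \<open>Path lifting: a step in \<open>B\<close> given by \<open>e\<close> lifts to a step in
  \<open>A\<close> given by any preimage of \<open>e\<close>.\<close>

lemma extension_component_lift:
  assumes f: "extension A B f" and a: "a \<in> carrier A" and b: "b \<in> component B (f a)"
  shows "\<exists>a'\<in>component A a. f a' = b"
proof -
  have "(f a, b) \<in> (inner_step B)\<^sup>*" using b by (simp add: component_def)
  then show ?thesis
  proof induction
    case base
    show ?case using component_refl[of a A] by auto
  next
    case (step c d)
    then obtain a' where a': "a' \<in> component A a" "f a' = c" by blast
    have A: "quandle A" "f \<in> quandle_hom A B" using f by (auto simp: extension_def)
    have a'A: "a' \<in> carrier A" using a' component_subset[OF A(1) a] by blast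
    obtain e where e: "e \<in> carrier B" "d = c \<triangleleft>\<^bsub>B\<^esub> e \<or> d = c \<triangleleft>\<inverse>\<^bsub>B\<^esub> e"
      using step by (auto simp: inner_step_def)
    obtain x where x: "x \<in> carrier A" "f x = e" using extension_surj[OF f e(1)] .
    have "a' \<triangleleft>\<^bsub>A\<^esub> x \<in> component A a" "a' \<triangleleft>\<inverse>\<^bsub>A\<^esub> x \<in> component A a"
      using component_op[OF A(1) a'A x(1)] component_inv[OF A(1) a'A x(1)]
        component_eqI[OF A(1) a'(1)] component_refl[of _ A] by metis+
    moreover have "f (a' \<triangleleft>\<^bsub>A\<^esub> x) = c \<triangleleft>\<^bsub>B\<^esub> e" "f (a' \<triangleleft>\<inverse>\<^bsub>A\<^esub> x) = c \<triangleleft>\<inverse>\<^bsub>B\<^esub> e"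
      using a' x a'A A(2) by (simp_all add: hom_op hom_inv)
    ultimately show ?case using e by blast
  qed
qed

text \<open>For an extension, the comparison map into the pullback of \<open>pi0_map\<close> and
  \<open>pi0_unit B\<close> is always a homomorphism, and it is onto by path lifting. Only
  injectivity is left, and a fibre of the comparison map consists of points of one component with
  the same image under \<open>f\<close>.\<close>

lemma trivial_extension_iff:
  "trivial_extension A B f \<longleftrightarrow> extension A B f \<and>
     (\<forall>a\<in>carrier A. \<forall>a'\<in>component A a. f a = f a' \<longrightarrow> a = a')"
proof (cases "extension A B f")
  case True
  then have A: "quandle A" and B: "quandle B" and f: "f \<in> quandle_hom A B"
    by (auto simp: extension_def)
  have map: "pi0_map A B f (component A a) = component B (f a)" if a: "a \<in> carrier A" for a
  proof -
    have "(THE Y. Y \<in> carrier (pi0 B) \<and> f ` component A a \<subseteq> Y) = component B (f a)"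
    proof (rule the_equality)
      show "component B (f a) \<in> carrier (pi0 B) \<and> f ` component A a \<subseteq> component B (f a)"
        using a f hom_component[OF f] by (auto simp: carrier_pi0 B hom_closed)
      \<comment> \<open>\<open>Y\<close> is itself a component and contains \<open>f a\<close>,
        since \<open>a\<close> lies in its own component.\<close>
      show "Y = component B (f a)" if "Y \<in> carrier (pi0 B) \<and> f ` component A a \<subseteq> Y" for Y
        using that component_refl[of a A] component_eqI[OF B, of "f a"]
        by (auto simp: carrier_pi0[OF B])
    qed
    then show ?thesis using a by (simp add: pi0_map_def carrier_pi0 A)
  qed
  have "pi0_unit A \<in> quandle_hom A (pi0 A)" "pi0_unit B \<in> quandle_hom B (pi0 B)"
    using A B by (auto intro: pi0_unit_hom)
  moreover have "pi0_map A B f \<in> quandle_hom (pi0 A) (pi0 B)"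
  proof (rule quandle_homI)
    show "pi0_map A B f \<in> extensional (carrier (pi0 A))" by (simp add: pi0_map_def)
    show "pi0_map A B f a \<in> carrier (pi0 B)" if "a \<in> carrier (pi0 A)" for a
      using that by (auto simp: carrier_pi0 A B map hom_closed[OF f])
  qed simp_all
  moreover have "compose (carrier A) (pi0_map A B f) (pi0_unit A) = compose (carrier A) (pi0_unit B) f"
    by (auto simp: compose_def pi0_unit_eq A B map hom_closed[OF f] fun_eq_iff)
  moreover have "(\<lambda>x\<in>carrier A. (pi0_unit A x, f x))
      \<in> quandle_hom A (pullback_quandle (pi0 A) B (pi0_map A B f) (pi0_unit B))"
    using A B f
    by (intro quandle_homI)
      (auto simp: pullback_quandle_def pi0_unit_eq carrier_pi0 map hom_closed
        hom_op hom_inv quandle.op_closed quandle.inv_closed component_op component_inv)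
  moreover have "(\<lambda>x\<in>carrier A. (pi0_unit A x, f x)) ` carrier A
      = carrier (pullback_quandle (pi0 A) B (pi0_map A B f) (pi0_unit B))"
  proof
    show "carrier (pullback_quandle (pi0 A) B (pi0_map A B f) (pi0_unit B))
        \<subseteq> (\<lambda>x\<in>carrier A. (pi0_unit A x, f x)) ` carrier A"
    proof
      fix y assume "y \<in> carrier (pullback_quandle (pi0 A) B (pi0_map A B f) (pi0_unit B))"
      then obtain a b where y: "y = (component A a, b)" "a \<in> carrier A" "b \<in> carrier B"
        "component B (f a) = component B b"
        by (auto simp: pullback_quandle_def carrier_pi0 A map pi0_unit_eq B)
      then have "b \<in> component B (f a)" using component_refl by metis
      \<comment> \<open>Moving \<open>a\<close> within its component gives a point over
        \<open>b\<close>.\<close>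
      then obtain a' where a': "a' \<in> component A a" "f a' = b"
        using extension_component_lift[OF True y(2)] by blast
      then have "a' \<in> carrier A" "component A a' = component A a"
        using component_subset[OF A y(2)] component_eqI[OF A] by blast+
      then show "y \<in> (\<lambda>x\<in>carrier A. (pi0_unit A x, f x)) ` carrier A"
        using y a' by (auto simp: pi0_unit_eq A intro!: image_eqI[of _ _ a'])
    qed
  qed (use A B f in \<open>auto simp: pullback_quandle_def carrier_pi0 map pi0_unit_eq hom_closed\<close>)
  ultimately have "is_pullback_square A (pi0 A) B (pi0 B) (pi0_unit A) f (pi0_map A B f) (pi0_unit B)
      \<longleftrightarrow> inj_on (\<lambda>x\<in>carrier A. (pi0_unit A x, f x)) (carrier A)"
    using f by (auto simp: is_pullback_square_def quandle_iso_def bij_betw_def)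
  also have "\<dots> \<longleftrightarrow> (\<forall>a\<in>carrier A. \<forall>a'\<in>component A a. f a = f a' \<longrightarrow> a = a')"
    using component_eqI[OF A] component_refl[of _ A] component_subset[OF A]
    by (simp add: inj_on_def pi0_unit_eq A) (metis subsetD)
  finally show ?thesis by (simp add: trivial_extension_def True)
qed (simp add: trivial_extension_def)

section \<open>Relabelled quandles and pullbacks\<close>

definition image_quandle :: "('a \<Rightarrow> 'b) \<Rightarrow> 'a quandle \<Rightarrow> 'b quandle" where
  "image_quandle h A =
     \<lparr>carrier = h ` carrier A,
      qop = (\<lambda>x y. h (inv_into (carrier A) h x \<triangleleft>\<^bsub>A\<^esub> inv_into (carrier A) h y)),
      qinv = (\<lambda>x y. h (inv_into (carrier A) h x \<triangleleft>\<inverse>\<^bsub>A\<^esub> inv_into (carrier A) h y))\<rparr>"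

lemma carrier_image_quandle [simp]: "carrier (image_quandle h A) = h ` carrier A"
  by (simp add: image_quandle_def)

lemma
  assumes "inj_on h (carrier A)" "a \<in> carrier A" "b \<in> carrier A"
  shows image_quandle_op: "h a \<triangleleft>\<^bsub>image_quandle h A\<^esub> h b = h (a \<triangleleft>\<^bsub>A\<^esub> b)"
    and image_quandle_inv: "h a \<triangleleft>\<inverse>\<^bsub>image_quandle h A\<^esub> h b = h (a \<triangleleft>\<inverse>\<^bsub>A\<^esub> b)"
  using assms by (simp_all add: image_quandle_def)

lemma quandle_image_quandle:
  assumes A: "quandle A" and h: "inj_on h (carrier A)"
  shows "quandle (image_quandle h A)"
proof -
  interpret quandle A by (rule A)
  note simps = image_quandle_op[OF h] image_quandle_inv[OF h] op_closed inv_closed idem op_inv inv_op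
  show ?thesis
  proof
    fix x y z
    assume "x \<in> carrier (image_quandle h A)" "y \<in> carrier (image_quandle h A)"
      "z \<in> carrier (image_quandle h A)"
    then obtain a b c where "x = h a" "y = h b" "z = h c"
      "a \<in> carrier A" "b \<in> carrier A" "c \<in> carrier A" by auto
    then show "(x \<triangleleft>\<^bsub>image_quandle h A\<^esub> y) \<triangleleft>\<^bsub>image_quandle h A\<^esub> z =
      (x \<triangleleft>\<^bsub>image_quandle h A\<^esub> z) \<triangleleft>\<^bsub>image_quandle h A\<^esub> (y \<triangleleft>\<^bsub>image_quandle h A\<^esub> z)"
      using self_distrib[of a b c] by (simp add: simps)
  qed (auto simp: simps)
qed

lemma inv_into_hom_image_quandle:
  assumes A: "quandle A" and h: "inj_on h (carrier A)"
  shows "(\<lambda>x\<in>h ` carrier A. inv_into (carrier A) h x) \<in> quandle_hom (image_quandle h A) A"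
  using quandle.op_closed[OF A] quandle.inv_closed[OF A] h
  by (intro quandle_homI)
    (auto simp: image_quandle_op image_quandle_inv, (metis inj_onD)+)

lemma carrier_pullback_quandle [simp]:
    "x \<in> carrier (pullback_quandle A B f g) \<longleftrightarrow>
      fst x \<in> carrier A \<and> snd x \<in> carrier B \<and> f (fst x) = g (snd x)"
  and op_pullback_quandle [simp]:
    "x \<triangleleft>\<^bsub>pullback_quandle A B f g\<^esub> y = (fst x \<triangleleft>\<^bsub>A\<^esub> fst y, snd x \<triangleleft>\<^bsub>B\<^esub> snd y)"
  and inv_pullback_quandle [simp]:
    "x \<triangleleft>\<inverse>\<^bsub>pullback_quandle A B f g\<^esub> y = (fst x \<triangleleft>\<inverse>\<^bsub>A\<^esub> fst y, snd x \<triangleleft>\<inverse>\<^bsub>B\<^esub> snd y)"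
  by (auto simp: pullback_quandle_def case_prod_beta)

lemma quandle_pullback_quandle:
  assumes A: "quandle A" and B: "quandle B" and f: "f \<in> quandle_hom A C" and g: "g \<in> quandle_hom B C"
  shows "quandle (pullback_quandle A B f g)"
proof -
  interpret A: quandle A by (rule A)
  interpret B: quandle B by (rule B)
  show ?thesis
  proof
    fix x y z
    assume "x \<in> carrier (pullback_quandle A B f g)" "y \<in> carrier (pullback_quandle A B f g)"
      "z \<in> carrier (pullback_quandle A B f g)"
    then show "(x \<triangleleft>\<^bsub>pullback_quandle A B f g\<^esub> y) \<triangleleft>\<^bsub>pullback_quandle A B f g\<^esub> z =
      (x \<triangleleft>\<^bsub>pullback_quandle A B f g\<^esub> z) \<triangleleft>\<^bsub>pullback_quandle A B f g\<^esub> (y \<triangleleft>\<^bsub>pullback_quandle A B f g\<^esub> z)"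
      using A.self_distrib[of "fst x" "fst y" "fst z"] B.self_distrib[of "snd x" "snd y" "snd z"] by simp
  qed (auto simp: A.op_closed A.inv_closed B.op_closed B.inv_closed A.idem B.idem A.op_inv B.op_inv
      A.inv_op B.inv_op hom_op[OF f] hom_op[OF g] hom_inv[OF f] hom_inv[OF g])
qed

text \<open>Changing the base of a pullback along \<open>k\<close>. It lets components of a pullback
  over a relabelled base be compared with those over the original base \<open>Q\<close>.\<close>

lemma pullback_quandle_map_hom:
  assumes P: "quandle (pullback_quandle E A (compose (carrier E) q k) f)" and k: "k \<in> quandle_hom E Q"
  shows "(\<lambda>x\<in>carrier (pullback_quandle E A (compose (carrier E) q k) f). (k (fst x), snd x))
    \<in> quandle_hom (pullback_quandle E A (compose (carrier E) q k) f) (pullback_quandle Q A q f)"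
    (is "?m \<in> quandle_hom ?P ?R")
proof (rule quandle_homI)
  fix x y assume x: "x \<in> carrier ?P" and y: "y \<in> carrier ?P"
  show "?m (x \<triangleleft>\<^bsub>?P\<^esub> y) = ?m x \<triangleleft>\<^bsub>?R\<^esub> ?m y"
    using quandle.op_closed[OF P x y] x y by (simp add: hom_op[OF k])
  show "?m (x \<triangleleft>\<inverse>\<^bsub>?P\<^esub> y) = ?m x \<triangleleft>\<inverse>\<^bsub>?R\<^esub> ?m y"
    using quandle.inv_closed[OF P x y] x y by (simp add: hom_inv[OF k])
qed (auto simp: hom_closed[OF k] compose_def)

lemma extension_pullback:
  assumes A: "quandle A" and p: "p \<in> quandle_hom A C" and g: "extension B C g"
  shows "extension (pullback_quandle A B p g) A (restrict fst (carrier (pullback_quandle A B p g)))"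
proof -
  let ?P = "pullback_quandle A B p g"
  have B: "quandle B" and gh: "g \<in> quandle_hom B C" using g by (auto simp: extension_def)
  have P: "quandle ?P" by (rule quandle_pullback_quandle[OF A B p gh])
  have "restrict fst (carrier ?P) \<in> quandle_hom ?P A"
    using quandle.op_closed[OF P] quandle.inv_closed[OF P] by (intro quandle_homI) auto
  moreover have "a \<in> restrict fst (carrier ?P) ` carrier ?P" if a: "a \<in> carrier A" for a
  proof -
    obtain b where "b \<in> carrier B" "g b = p a"
      using extension_surj[OF g hom_closed[OF p a]] .
    then have "(a, b) \<in> carrier ?P" using a by simp
    then show ?thesis by (metis fst_conv imageI restrict_apply')
  qed
  ultimately show ?thesis
    using A P by (auto simp: extension_def)
qed

section \<open>Central extensions are coverings\<close>

definition covering :: "'a quandle \<Rightarrow> 'b quandle \<Rightarrow> ('a \<Rightarrow> 'b) \<Rightarrow> bool" where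
  "covering A B f \<longleftrightarrow> extension A B f \<and>
     (\<forall>a\<in>carrier A. \<forall>a'\<in>carrier A. f a = f a' \<longrightarrow> (\<forall>c\<in>carrier A. c \<triangleleft>\<^bsub>A\<^esub> a = c \<triangleleft>\<^bsub>A\<^esub> a'))"

lemma covering_op:
  "\<lbrakk>covering A B f; a \<in> carrier A; a' \<in> carrier A; c \<in> carrier A; f a = f a'\<rbrakk>
    \<Longrightarrow> c \<triangleleft>\<^bsub>A\<^esub> a = c \<triangleleft>\<^bsub>A\<^esub> a'"
  unfolding covering_def by blast

lemma covering_inv:
  assumes f: "covering A B f" and a: "a \<in> carrier A" "a' \<in> carrier A" "c \<in> carrier A" "f a = f a'"
  shows "c \<triangleleft>\<inverse>\<^bsub>A\<^esub> a = c \<triangleleft>\<inverse>\<^bsub>A\<^esub> a'"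
proof -
  interpret quandle A using f by (simp add: covering_def extension_def)
  have "(c \<triangleleft>\<inverse>\<^bsub>A\<^esub> a) \<triangleleft>\<^bsub>A\<^esub> a' = c"
    using covering_op[OF f a(1,2) _ a(4), of "c \<triangleleft>\<inverse>\<^bsub>A\<^esub> a"] a by (simp add: inv_closed inv_op)
  then show ?thesis
    using a op_eq_iff by (simp add: inv_closed)
qed

text \<open>Lift \<open>a\<close> and \<open>a'\<close> to the pullback over one common point
  \<open>e\<close> of the trivializing base. Both translates of \<open>(d, c)\<close> lie in the
  component of \<open>(d, c)\<close> and over the same point of \<open>E\<close>, so triviality
  makes them equal.\<close>

lemma central_extension_imp_covering:
  assumes "central_extension A B f"
  shows "covering A B f"
proof -
  obtain E :: "'a quandle" and p where f: "extension A B f" and p: "extension E B p"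
    and triv: "trivial_extension (pullback_quandle E A p f) E
      (restrict fst (carrier (pullback_quandle E A p f)))"
    using assms by (auto simp: central_extension_def)
  let ?P = "pullback_quandle E A p f"
  have E: "quandle E" "p \<in> quandle_hom E B" and A: "quandle A" "f \<in> quandle_hom A B"
    using f p by (auto simp: extension_def)
  have P: "quandle ?P" by (rule quandle_pullback_quandle[OF E(1) A(1) E(2) A(2)])
  have "c \<triangleleft>\<^bsub>A\<^esub> a = c \<triangleleft>\<^bsub>A\<^esub> a'"
    if a: "a \<in> carrier A" "a' \<in> carrier A" "f a = f a'" and c: "c \<in> carrier A" for a a' c
  proof -
    obtain e where e: "e \<in> carrier E" "p e = f a"
      using extension_surj[OF p hom_closed[OF A(2) a(1)]] .
    obtain d where d: "d \<in> carrier E" "p d = f c"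
      using extension_surj[OF p hom_closed[OF A(2) c]] .
    have mem: "(d, c) \<in> carrier ?P" "(e, a) \<in> carrier ?P" "(e, a') \<in> carrier ?P"
      using a c d e by auto
    have "(d, c) \<triangleleft>\<^bsub>?P\<^esub> (e, a') \<in> component ?P ((d, c) \<triangleleft>\<^bsub>?P\<^esub> (e, a))"
      using component_op[OF P mem(1,2)] component_op[OF P mem(1,3)] component_refl by metis
    moreover have "(d, c) \<triangleleft>\<^bsub>?P\<^esub> (e, a) \<in> carrier ?P" "(d, c) \<triangleleft>\<^bsub>?P\<^esub> (e, a') \<in> carrier ?P"
      using mem quandle.op_closed[OF P] by blast+
    ultimately have "(d, c) \<triangleleft>\<^bsub>?P\<^esub> (e, a) = (d, c) \<triangleleft>\<^bsub>?P\<^esub> (e, a')"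
      using triv unfolding trivial_extension_iff
      by (metis (no_types, lifting) fst_conv op_pullback_quandle restrict_apply')
    then show ?thesis by simp
  qed
  then show ?thesis using f unfolding covering_def by blast
qed

text \<open>
  A triple \<open>(b, c, e)\<close> records the transport \<open>e\<close> from the fibre of \<open>f\<close> over \<open>b\<close> to the fibre over
  \<open>c\<close> along a word of translations; for a covering \<open>f\<close>, the translation by \<open>a\<close> depends on \<open>f a\<close> only,
  so any section of \<open>f\<close> can be used.
\<close>

inductive_set path_carrier :: "'a quandle \<Rightarrow> 'b quandle \<Rightarrow> ('a \<Rightarrow> 'b) \<Rightarrow> ('b \<times> 'b \<times> ('a \<Rightarrow> 'a)) set"
  for A B f where
  base: "b \<in> carrier B \<Longrightarrow> (b, b, \<lambda>x\<in>{x \<in> carrier A. f x = b}. x) \<in> path_carrier A B f"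
| op: "(b, c, e) \<in> path_carrier A B f \<Longrightarrow> d \<in> carrier B \<Longrightarrow>
    (b, c \<triangleleft>\<^bsub>B\<^esub> d, \<lambda>x\<in>{x \<in> carrier A. f x = b}. e x \<triangleleft>\<^bsub>A\<^esub> inv_into (carrier A) f d)
      \<in> path_carrier A B f"
| inv: "(b, c, e) \<in> path_carrier A B f \<Longrightarrow> d \<in> carrier B \<Longrightarrow>
    (b, c \<triangleleft>\<inverse>\<^bsub>B\<^esub> d, \<lambda>x\<in>{x \<in> carrier A. f x = b}. e x \<triangleleft>\<inverse>\<^bsub>A\<^esub> inv_into (carrier A) f d)
      \<in> path_carrier A B f"

text \<open>The right-hand factor acts only through its endpoint \<open>d\<close>, and it prolongs
  the left-hand transport. The source \<open>b\<close> is therefore constant on components, which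
  keeps transports in one component comparable.\<close>

definition path_quandle ::
    "'a quandle \<Rightarrow> 'b quandle \<Rightarrow> ('a \<Rightarrow> 'b) \<Rightarrow> ('b \<times> 'b \<times> ('a \<Rightarrow> 'a)) quandle" where
  "path_quandle A B f =
     \<lparr>carrier = path_carrier A B f,
      qop = (\<lambda>(b, c, e) (_, d, _). (b, c \<triangleleft>\<^bsub>B\<^esub> d,
        \<lambda>x\<in>{x \<in> carrier A. f x = b}. e x \<triangleleft>\<^bsub>A\<^esub> inv_into (carrier A) f d)),
      qinv = (\<lambda>(b, c, e) (_, d, _). (b, c \<triangleleft>\<inverse>\<^bsub>B\<^esub> d,
        \<lambda>x\<in>{x \<in> carrier A. f x = b}. e x \<triangleleft>\<inverse>\<^bsub>A\<^esub> inv_into (carrier A) f d))\<rparr>"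

context
  fixes A :: "'a quandle" and B :: "'b quandle" and f
  assumes cov: "covering A B f"
begin

private abbreviation "fib b \<equiv> {x \<in> carrier A. f x = b}"
private abbreviation "sec \<equiv> inv_into (carrier A) f"

private lemma f_ext: "extension A B f" and quandle_A: "quandle A" and quandle_B: "quandle B"
  and f_hom: "f \<in> quandle_hom A B"
  using cov by (simp_all add: covering_def extension_def)

interpretation A: quandle A by (rule quandle_A)
interpretation B: quandle B by (rule quandle_B)

private lemma sec: "b \<in> carrier B \<Longrightarrow> sec b \<in> carrier A \<and> f (sec b) = b"
  using f_ext by (metis extension_def f_inv_into_f inv_into_into)

text \<open>Every letter can be undone, so a transport maps its source fibre onto its target fibre.
  Surjectivity is the point: each element over the endpoint is a value of the transport.\<close>

lemma path_carrier_props: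
  assumes "(b, c, e) \<in> path_carrier A B f"
  shows "c \<in> carrier B" "e \<in> extensional (fib b)" "e ` fib b = fib c"
proof -
  have "c \<in> carrier B \<and> e \<in> extensional (fib b) \<and> e ` fib b = fib c"
    using assms
  proof induction
    case (op b c e d)
    have "y \<in> (\<lambda>x\<in>fib b. e x \<triangleleft>\<^bsub>A\<^esub> sec d) ` fib b" if y: "y \<in> fib (c \<triangleleft>\<^bsub>B\<^esub> d)" for y
    proof -
      have "y \<triangleleft>\<inverse>\<^bsub>A\<^esub> sec d \<in> e ` fib b"
        using op sec[of d] y by (auto simp: A.inv_closed hom_inv[OF f_hom] B.op_inv)
      then obtain x where "x \<in> fib b" "e x = y \<triangleleft>\<inverse>\<^bsub>A\<^esub> sec d" by force
      then show ?thesis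
        using op sec[of d] y by (intro image_eqI[of _ _ x]) (simp_all add: A.inv_op)
    qed
    moreover have "e x \<triangleleft>\<^bsub>A\<^esub> sec d \<in> fib (c \<triangleleft>\<^bsub>B\<^esub> d)" if "x \<in> fib b" for x
    proof -
      have "e x \<in> fib c" using op.IH that by blast
      then show ?thesis using sec[OF op.hyps(2)] by (simp add: A.op_closed hom_op[OF f_hom])
    qed
    ultimately have "(\<lambda>x\<in>fib b. e x \<triangleleft>\<^bsub>A\<^esub> sec d) ` fib b = fib (c \<triangleleft>\<^bsub>B\<^esub> d)"
      by (intro subset_antisym image_subsetI subsetI) simp_all
    then show ?case
      using op by (simp only: B.op_closed restrict_extensional simp_thms)
  next
    case (inv b c e d)
    have "y \<in> (\<lambda>x\<in>fib b. e x \<triangleleft>\<inverse>\<^bsub>A\<^esub> sec d) ` fib b" if y: "y \<in> fib (c \<triangleleft>\<inverse>\<^bsub>B\<^esub> d)" for y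
    proof -
      have "y \<triangleleft>\<^bsub>A\<^esub> sec d \<in> e ` fib b"
        using inv sec[of d] y by (auto simp: A.op_closed hom_op[OF f_hom] B.inv_op)
      then obtain x where "x \<in> fib b" "e x = y \<triangleleft>\<^bsub>A\<^esub> sec d" by force
      then show ?thesis
        using inv sec[of d] y by (intro image_eqI[of _ _ x]) (simp_all add: A.op_inv)
    qed
    moreover have "e x \<triangleleft>\<inverse>\<^bsub>A\<^esub> sec d \<in> fib (c \<triangleleft>\<inverse>\<^bsub>B\<^esub> d)" if "x \<in> fib b" for x
    proof -
      have "e x \<in> fib c" using inv.IH that by blast
      then show ?thesis using sec[OF inv.hyps(2)] by (simp add: A.inv_closed hom_inv[OF f_hom])
    qed
    ultimately have "(\<lambda>x\<in>fib b. e x \<triangleleft>\<inverse>\<^bsub>A\<^esub> sec d) ` fib b = fib (c \<triangleleft>\<inverse>\<^bsub>B\<^esub> d)"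
      by (intro subset_antisym image_subsetI subsetI) simp_all
    then show ?case
      using inv by (simp only: B.inv_closed restrict_extensional simp_thms)
  next
    case (base b)
    then show ?case by (simp only: restrict_extensional) auto
  qed
  then show "c \<in> carrier B" "e \<in> extensional (fib b)" "e ` fib b = fib c" by auto
qed

private lemma transport: "(b, c, e) \<in> path_carrier A B f \<Longrightarrow> x \<in> carrier A \<Longrightarrow> f x = b
    \<Longrightarrow> e x \<in> carrier A \<and> f (e x) = c"
  using path_carrier_props(3) by blast

private lemma restrict_transport:
  "(b, c, e) \<in> path_carrier A B f \<Longrightarrow> (\<And>x. x \<in> carrier A \<Longrightarrow> f x = b \<Longrightarrow> e' x = e x)
    \<Longrightarrow> (\<lambda>x\<in>fib b. e' x) = e"
  by (rule extensionalityI[of _ "fib b"]) (auto intro: path_carrier_props)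

text \<open>The covering property enters twice. For idempotence, \<open>sec c\<close> may be
  replaced by \<open>e y\<close>, which lies over \<open>c\<close> too, so idempotence of
  \<open>A\<close> applies. For self-distributivity, the translate of \<open>sec d\<close> by
  \<open>sec g\<close> lies in the same fibre as \<open>sec (d \<triangleleft> g)\<close>, although
  \<open>sec\<close> need not be a homomorphism.\<close>

lemma quandle_path_quandle: "quandle (path_quandle A B f)"
proof
  fix x y z
  assume x: "x \<in> carrier (path_quandle A B f)"
  obtain b c e where xe: "x = (b, c, e)" by (cases x)
  then have x': "(b, c, e) \<in> path_carrier A B f" using x by (simp add: path_quandle_def)
  note xs = path_carrier_props(1)[OF x'] transport[OF x']
  have "e y \<triangleleft>\<^bsub>A\<^esub> sec c = e y" if "y \<in> carrier A" "f y = b" for y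
    using covering_op[OF cov, of "sec c" "e y" "e y"] sec[of c] xs that by (simp add: A.idem)
  then show "x \<triangleleft>\<^bsub>path_quandle A B f\<^esub> x = x"
    using restrict_transport[OF x'] xs by (simp add: xe path_quandle_def B.idem)
  assume y: "y \<in> carrier (path_quandle A B f)"
  obtain b2 d e2 where ye: "y = (b2, d, e2)" by (cases y)
  then have y': "(b2, d, e2) \<in> path_carrier A B f" using y by (simp add: path_quandle_def)
  note ys = path_carrier_props(1)[OF y']
  show "x \<triangleleft>\<^bsub>path_quandle A B f\<^esub> y \<in> carrier (path_quandle A B f)"
    using path_carrier.op[OF x' ys] by (simp add: path_quandle_def xe ye)
  show "x \<triangleleft>\<inverse>\<^bsub>path_quandle A B f\<^esub> y \<in> carrier (path_quandle A B f)"
    using path_carrier.inv[OF x' ys] by (simp add: path_quandle_def xe ye)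
  show "(x \<triangleleft>\<^bsub>path_quandle A B f\<^esub> y) \<triangleleft>\<inverse>\<^bsub>path_quandle A B f\<^esub> y = x"
    using restrict_transport[OF x'] xs ys sec[of d]
    by (simp add: path_quandle_def xe ye B.op_inv A.op_inv)
  show "(x \<triangleleft>\<inverse>\<^bsub>path_quandle A B f\<^esub> y) \<triangleleft>\<^bsub>path_quandle A B f\<^esub> y = x"
    using restrict_transport[OF x'] xs ys sec[of d]
    by (simp add: path_quandle_def xe ye B.inv_op A.inv_op)
  assume z: "z \<in> carrier (path_quandle A B f)"
  obtain b3 g e3 where ze: "z = (b3, g, e3)" by (cases z)
  then have "(b3, g, e3) \<in> path_carrier A B f" using z by (simp add: path_quandle_def)
  note zs = path_carrier_props(1)[OF this]
  have "(e v \<triangleleft>\<^bsub>A\<^esub> sec d) \<triangleleft>\<^bsub>A\<^esub> sec g = (e v \<triangleleft>\<^bsub>A\<^esub> sec g) \<triangleleft>\<^bsub>A\<^esub> sec (d \<triangleleft>\<^bsub>B\<^esub> g)"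
    if v: "v \<in> carrier A" "f v = b" for v
  proof -
    have "(e v \<triangleleft>\<^bsub>A\<^esub> sec d) \<triangleleft>\<^bsub>A\<^esub> sec g = (e v \<triangleleft>\<^bsub>A\<^esub> sec g) \<triangleleft>\<^bsub>A\<^esub> (sec d \<triangleleft>\<^bsub>A\<^esub> sec g)"
      using xs(2)[OF v] sec[OF ys] sec[OF zs] by (intro A.self_distrib) simp_all
    also have "\<dots> = (e v \<triangleleft>\<^bsub>A\<^esub> sec g) \<triangleleft>\<^bsub>A\<^esub> sec (d \<triangleleft>\<^bsub>B\<^esub> g)"
      using xs(2)[OF v] sec[OF ys] sec[OF zs] sec[OF B.op_closed[OF ys zs]]
      by (intro covering_op[OF cov]) (auto simp: A.op_closed hom_op[OF f_hom])
    finally show ?thesis .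
  qed
  then show "(x \<triangleleft>\<^bsub>path_quandle A B f\<^esub> y) \<triangleleft>\<^bsub>path_quandle A B f\<^esub> z =
      (x \<triangleleft>\<^bsub>path_quandle A B f\<^esub> z) \<triangleleft>\<^bsub>path_quandle A B f\<^esub> (y \<triangleleft>\<^bsub>path_quandle A B f\<^esub> z)"
    using xs(1) ys zs
    by (auto simp: path_quandle_def xe ye ze B.self_distrib[symmetric] fun_eq_iff restrict_def)
qed

private abbreviation "endpoint \<equiv> (\<lambda>x\<in>path_carrier A B f. fst (snd x))"

lemma extension_path_quandle: "extension (path_quandle A B f) B endpoint"
proof -
  have hom: "endpoint \<in> quandle_hom (path_quandle A B f) B"
    using quandle.op_closed[OF quandle_path_quandle] quandle.inv_closed[OF quandle_path_quandle]
      path_carrier_props(1)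
    by (intro quandle_homI) (force simp: path_quandle_def)+
  have onto: "b \<in> endpoint ` carrier (path_quandle A B f)" if "b \<in> carrier B" for b
    using path_carrier.base[OF that, of A f]
    by (intro image_eqI[of _ _ "(b, b, \<lambda>x\<in>fib b. x)"]) (simp_all add: path_quandle_def)
  have "endpoint ` carrier (path_quandle A B f) = carrier B"
    by (rule equalityI[OF image_subsetI subsetI]) (rule hom_closed[OF hom] onto, assumption)+
  then show ?thesis
    using hom quandle_path_quandle quandle_B by (simp only: extension_def simp_thms)
qed

text \<open>A path in the pullback acts on the transport and on the point of \<open>A\<close> by the
  same translations. If \<open>e u = v\<close> at the start, the later transport still sends
  \<open>u\<close> to the later point. Equal transports at both ends then force equal
  points.\<close>

lemma component_pullback_path_quandle:
  assumes x: "x \<in> carrier (pullback_quandle (path_quandle A B f) A endpoint f)"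
    and y: "y \<in> component (pullback_quandle (path_quandle A B f) A endpoint f) x"
    and eq: "fst x = fst y"
  shows "x = y"
proof -
  let ?P = "pullback_quandle (path_quandle A B f) A endpoint f"
  obtain b c e v where xe: "x = ((b, c, e), v)" by (cases x) auto
  have x': "(b, c, e) \<in> path_carrier A B f" "v \<in> carrier A" "f v = c"
    using x by (auto simp: xe path_quandle_def)
  have "fst (fst y) = b \<and> (\<forall>u\<in>fib b. e u = v \<longrightarrow> snd (snd (fst y)) u = snd y)"
    using y unfolding component_def Image_singleton mem_Collect_eq
  proof induction
    case base
    then show ?case by (simp add: xe)
  next
    case (step y z)
    obtain b' d i v2 where "y = ((b', d, i), v2)" by (cases y) auto
    then have y: "y = ((b, d, i), v2)" "\<And>u. u \<in> fib b \<Longrightarrow> e u = v \<Longrightarrow> i u = v2"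
      using step.IH by auto
    obtain w where w: "w \<in> carrier ?P" "z = y \<triangleleft>\<^bsub>?P\<^esub> w \<or> z = y \<triangleleft>\<inverse>\<^bsub>?P\<^esub> w" and yP: "y \<in> carrier ?P"
      using step.hyps(2) unfolding inner_step_def by blast
    obtain b3 g k v3 where we: "w = ((b3, g, k), v3)" by (cases w) auto
    have g: "v2 \<in> carrier A" "v3 \<in> carrier A" "f v3 = g"
      using w(1) yP by (auto simp: we y path_quandle_def)
    have "sec g \<in> carrier A" "f (sec g) = g"
      using sec[of g] g hom_closed[OF f_hom, of v3] by auto
    \<comment> \<open>The transport moves by \<open>sec g\<close> and the point by
      \<open>v3\<close>; both lie over \<open>g\<close>.\<close>
    then have "v2 \<triangleleft>\<^bsub>A\<^esub> sec g = v2 \<triangleleft>\<^bsub>A\<^esub> v3" "v2 \<triangleleft>\<inverse>\<^bsub>A\<^esub> sec g = v2 \<triangleleft>\<inverse>\<^bsub>A\<^esub> v3"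
      using covering_op[OF cov, of "sec g" v3 v2] covering_inv[OF cov, of "sec g" v3 v2] g by auto
    then show ?case
      using w(2) by (auto simp: y we path_quandle_def)
  qed
  \<comment> \<open>The invariant is informative only if some \<open>u\<close> is sent to
    \<open>v\<close>; surjectivity of \<open>e\<close> onto the fibre supplies one.\<close>
  moreover have "v \<in> e ` fib b"
    using path_carrier_props(3)[OF x'(1)] x' by simp
  then obtain u where "u \<in> fib b" "e u = v" by blast
  ultimately show ?thesis
    using eq by (auto simp: xe prod_eq_iff)
qed

end

text \<open>
  Two letters \<open>t, d\<close> code the translation by \<open>d\<close> if \<open>t = d\<close>, and its inverse otherwise. The coding
  shows that \<open>path_carrier A B f\<close> is small enough to be transferred to the type of elements of \<open>B\<close>.
\<close>

fun path_of_list :: "'a quandle \<Rightarrow> 'b quandle \<Rightarrow> ('a \<Rightarrow> 'b) \<Rightarrow> 'b list \<Rightarrow> 'b \<times> 'b \<times> ('a \<Rightarrow> 'a)" where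
  "path_of_list A B f [b] = (b, b, \<lambda>x\<in>{x \<in> carrier A. f x = b}. x)"
| "path_of_list A B f (t # d # w) = (case path_of_list A B f w of (b, c, e) \<Rightarrow>
     if t = d
     then (b, c \<triangleleft>\<^bsub>B\<^esub> d, \<lambda>x\<in>{x \<in> carrier A. f x = b}. e x \<triangleleft>\<^bsub>A\<^esub> inv_into (carrier A) f d)
     else (b, c \<triangleleft>\<inverse>\<^bsub>B\<^esub> d, \<lambda>x\<in>{x \<in> carrier A. f x = b}. e x \<triangleleft>\<inverse>\<^bsub>A\<^esub> inv_into (carrier A) f d))"

text \<open>Lists of even length are not words and have unspecified values, which is harmless
  because only an inclusion into the range is claimed.\<close>

lemma path_carrier_subset_range:
  fixes B :: "'b quandle"
  assumes inf: "infinite (UNIV :: 'b set)"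
  shows "path_carrier A B f \<subseteq> range (path_of_list A B f)"
proof -
  have "(b, c, e) \<in> range (path_of_list A B f)" if "(b, c, e) \<in> path_carrier A B f" for b c e
    using that
  proof induction
    case (base b)
    show ?case by (rule range_eqI, rule path_of_list.simps(1)[symmetric])
  next
    case (op b c e d)
    then obtain w where "path_of_list A B f w = (b, c, e)" by (metis imageE)
    then have "path_of_list A B f (d # d # w) = (b, c \<triangleleft>\<^bsub>B\<^esub> d,
        \<lambda>x\<in>{x \<in> carrier A. f x = b}. e x \<triangleleft>\<^bsub>A\<^esub> inv_into (carrier A) f d)"
      unfolding path_of_list.simps by simp
    then show ?case by (rule range_eqI[OF sym])
  next
    case (inv b c e d)
    then obtain w where "path_of_list A B f w = (b, c, e)" by (metis imageE)
    \<comment> \<open>An inverse letter needs a marker other than \<open>d\<close>, hence a second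
      element of the type.\<close>
    moreover obtain t where "t \<noteq> d"
      using ex_new_if_finite[OF inf, of "{d}"] by auto
    ultimately have "path_of_list A B f (t # d # w) = (b, c \<triangleleft>\<inverse>\<^bsub>B\<^esub> d,
        \<lambda>x\<in>{x \<in> carrier A. f x = b}. e x \<triangleleft>\<inverse>\<^bsub>A\<^esub> inv_into (carrier A) f d)"
      unfolding path_of_list.simps by simp
    then show ?case by (rule range_eqI[OF sym])
  qed
  then show ?thesis by auto
qed

section \<open>Coding pairs and lists in an infinite type\<close>

lemma infinite_inj_pair:
  assumes "infinite (UNIV :: 'u set)"
  shows "\<exists>h :: 'u \<times> 'u \<Rightarrow> 'u. inj h"
  using card_of_Times_same_infinite[OF assms] card_of_ordIso[of "UNIV \<times> UNIV" UNIV]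
  by (auto simp: bij_betw_def)

text \<open>Nested pairing is shown to separate lists of equal length only, because the end marker
  \<open>n 0\<close> may itself be the code of a pair. The length, embedded by \<open>n\<close>, is
  therefore added to the code.\<close>

lemma infinite_inj_list:
  assumes inf: "infinite (UNIV :: 'u set)"
  shows "\<exists>h :: 'u list \<Rightarrow> 'u. inj h"
proof -
  obtain p :: "'u \<times> 'u \<Rightarrow> 'u" where p: "inj p" using infinite_inj_pair[OF inf] by blast
  obtain n :: "nat \<Rightarrow> 'u" where n: "inj n" using infinite_countable_subset[OF inf] by blast
  define code where "code w = foldr (\<lambda>x y. p (x, y)) w (n 0)" for w
  have "w = w'" if "length w = length w'" "code w = code w'" for w w'
    using that by (induction rule: list_induct2) (auto simp: code_def dest: injD[OF p])
  then have "inj (\<lambda>w. p (n (length w), code w))"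
    by (auto intro!: injI dest!: injD[OF p] injD[OF n])
  then show ?thesis by blast
qed

lemma trivial_extension_restrict_fstI:
  assumes P: "quandle P" and ext: "extension P E (restrict fst (carrier P))"
    and inj: "\<And>x y. x \<in> carrier P \<Longrightarrow> y \<in> component P x \<Longrightarrow> fst x = fst y \<Longrightarrow> x = y"
  shows "trivial_extension P E (restrict fst (carrier P))"
  unfolding trivial_extension_iff
proof (intro conjI ballI impI ext)
  fix x y assume xy: "x \<in> carrier P" "y \<in> component P x"
    and "restrict fst (carrier P) x = restrict fst (carrier P) y"
  moreover have "y \<in> carrier P" using component_subset[OF P xy(1)] xy(2) by blast
  ultimately show "x = y" using inj by simp
qed

lemma covering_imp_central_extension:
  fixes A B :: "'u quandle"
  assumes inf: "infinite (UNIV :: 'u set)" and cov: "covering A B f"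
  shows "central_extension A B f"
proof -
  let ?Q = "path_quandle A B f" and ?q = "\<lambda>x\<in>path_carrier A B f. fst (snd x)"
  note Q = quandle_path_quandle[OF cov]
  obtain l :: "'u list \<Rightarrow> 'u" where l: "inj l" using infinite_inj_list[OF inf] by blast
  \<comment> \<open>A path is coded by a chosen list that produces it, and the list by an element of
    \<open>'u\<close>.\<close>
  define h where "h = l \<circ> inv_into UNIV (path_of_list A B f)"
  have h: "inj_on h (carrier ?Q)"
    unfolding h_def
    by (rule comp_inj_on[OF inj_on_inv_into inj_on_subset[OF l subset_UNIV]])
      (simp add: path_quandle_def path_carrier_subset_range[OF inf])
  let ?E = "image_quandle h ?Q" and ?k = "\<lambda>x\<in>h ` carrier ?Q. inv_into (carrier ?Q) h x"
  let ?p = "compose (carrier ?E) ?q ?k"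
  have f: "extension A B f" "quandle A" "f \<in> quandle_hom A B"
    using cov by (auto simp: covering_def extension_def)
  have q: "?q \<in> quandle_hom ?Q B" "?q ` carrier ?Q = carrier B"
    using extension_path_quandle[OF cov] by (auto simp: extension_def)
  have E: "quandle ?E" and k: "?k \<in> quandle_hom ?E ?Q"
    using quandle_image_quandle[OF Q h] inv_into_hom_image_quandle[OF Q h] by auto
  have p: "?p \<in> quandle_hom ?E B" by (rule quandle_hom_compose[OF E k q(1)])
  have p_h: "?p (h x) = ?q x" if "x \<in> carrier ?Q" for x
    using that h by (simp add: compose_def)
  have "?p ` carrier ?E = carrier B"
    using p_h q(2) by (auto simp: image_image)
  then have ext: "extension ?E B ?p"
    using E p f(1) by (auto simp: extension_def)
  let ?P = "pullback_quandle ?E A ?p f" and ?R = "pullback_quandle ?Q A ?q f"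
  let ?m = "\<lambda>x\<in>carrier ?P. (?k (fst x), snd x)"
  have P: "quandle ?P" by (rule quandle_pullback_quandle[OF E f(2) p f(3)])
  have m: "?m \<in> quandle_hom ?P ?R"
    by (rule pullback_quandle_map_hom[OF P k])
  have "x = y" if x: "x \<in> carrier ?P" and y: "y \<in> component ?P x" and eq: "fst x = fst y" for x y
  proof -
    have yP: "y \<in> carrier ?P" using component_subset[OF P x] y by blast
    \<comment> \<open>The injectivity known for the uncoded base applies to the images under
      \<open>?m\<close>, since homomorphisms preserve components.\<close>
    have "?m x = ?m y"
      using component_pullback_path_quandle[OF cov hom_closed[OF m x] hom_component[OF m y]]
        x yP eq by simp
    then show ?thesis using x yP eq by (simp add: prod_eq_iff)
  qed
  then have "trivial_extension ?P ?E (restrict fst (carrier ?P))"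
    by (intro trivial_extension_restrict_fstI[OF P] extension_pullback[OF E p f(1)])
  then show ?thesis
    using ext f(1) by (auto simp: central_extension_def)
qed

lemma central_extension_iff_covering:
  fixes A B :: "'u quandle"
  assumes "infinite (UNIV :: 'u set)"
  shows "central_extension A B f \<longleftrightarrow> covering A B f"
  using assms covering_imp_central_extension central_extension_imp_covering by blast

section \<open>The category of extensions\<close>

lemma is_category_Qnd: "is_category Qnd"
  unfolding is_category_def
proof (intro conjI ballI)
  fix W X Y Z f g h
  assume "W \<in> Obj Qnd" "X \<in> Obj Qnd" "Y \<in> Obj Qnd" "Z \<in> Obj Qnd"
    and f: "f \<in> Hom Qnd W X" and "g \<in> Hom Qnd X Y" "h \<in> Hom Qnd Y Z"
  show "Comp Qnd W Y Z h (Comp Qnd W X Y g f) = Comp Qnd W X Z (Comp Qnd X Y Z h g) f"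
    using f hom_closed[of f W X] by (simp add: Qnd_def compose_def fun_eq_iff)
qed (auto simp: Qnd_def quandle_hom_id quandle_hom_compose[unfolded compose_def] compose_def hom_closed hom_restrict
    cong: restrict_cong)

lemma is_category_Ext_Qnd: "is_category Ext_Qnd"
  unfolding Ext_Qnd_def
  by (intro is_category_full_subcategory is_category_arrow_category is_category_Qnd)

lemma Obj_Ext_Qnd: "(A, B, f) \<in> Obj Ext_Qnd \<longleftrightarrow> extension A B f"
  by (auto simp: Ext_Qnd_def arrow_category_def Qnd_def extension_def)

lemma Hom_Ext_Qnd:
  "(\<alpha>\<^sub>1, \<alpha>\<^sub>0) \<in> Hom Ext_Qnd (A, B, f) (A', B', g) \<longleftrightarrow>
     \<alpha>\<^sub>1 \<in> quandle_hom A A' \<and> \<alpha>\<^sub>0 \<in> quandle_hom B B' \<and> (\<forall>a\<in>carrier A. \<alpha>\<^sub>0 (f a) = g (\<alpha>\<^sub>1 a))"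
  by (auto simp: Ext_Qnd_def arrow_category_def Qnd_def compose_def restrict_def fun_eq_iff)

lemma Comp_Ext_Qnd:
  "Comp Ext_Qnd (A, B, f) (A', B', g) (A'', B'', h) (\<beta>\<^sub>1, \<beta>\<^sub>0) (\<alpha>\<^sub>1, \<alpha>\<^sub>0) =
     (compose (carrier A) \<beta>\<^sub>1 \<alpha>\<^sub>1, compose (carrier B) \<beta>\<^sub>0 \<alpha>\<^sub>0)"
  by (simp add: Ext_Qnd_def arrow_category_def Qnd_def)

text \<open>Surjections are epimorphisms; extensionality turns agreement on \<open>carrier B\<close>
  into equality of functions.\<close>

lemma extension_cancel:
  assumes "extension A B f" "g \<in> extensional (carrier B)" "h \<in> extensional (carrier B)"
    and "compose (carrier A) g f = compose (carrier A) h f"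
  shows "g = h"
proof (rule extensionalityI[OF assms(2,3)])
  fix b assume "b \<in> carrier B"
  then obtain a where a: "a \<in> carrier A" "f a = b" using extension_surj[OF assms(1)] by metis
  show "g b = h b"
    using fun_cong[OF assms(4), of a] a by (simp add: compose_def)
qed

section \<open>The reflection onto coverings\<close>

inductive_set covering_cong :: "'a quandle \<Rightarrow> ('a \<Rightarrow> 'b) \<Rightarrow> 'a rel" for A f where
  gen: "\<lbrakk>a \<in> carrier A; a' \<in> carrier A; c \<in> carrier A; f a = f a'\<rbrakk>
    \<Longrightarrow> (c \<triangleleft>\<^bsub>A\<^esub> a, c \<triangleleft>\<^bsub>A\<^esub> a') \<in> covering_cong A f"
| refl: "a \<in> carrier A \<Longrightarrow> (a, a) \<in> covering_cong A f"
| sym: "(a, b) \<in> covering_cong A f \<Longrightarrow> (b, a) \<in> covering_cong A f"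
| trans: "\<lbrakk>(a, b) \<in> covering_cong A f; (b, c) \<in> covering_cong A f\<rbrakk> \<Longrightarrow> (a, c) \<in> covering_cong A f"
| op: "\<lbrakk>(a, a') \<in> covering_cong A f; (b, b') \<in> covering_cong A f\<rbrakk>
    \<Longrightarrow> (a \<triangleleft>\<^bsub>A\<^esub> b, a' \<triangleleft>\<^bsub>A\<^esub> b') \<in> covering_cong A f"
| inv: "\<lbrakk>(a, a') \<in> covering_cong A f; (b, b') \<in> covering_cong A f\<rbrakk>
    \<Longrightarrow> (a \<triangleleft>\<inverse>\<^bsub>A\<^esub> b, a' \<triangleleft>\<inverse>\<^bsub>A\<^esub> b') \<in> covering_cong A f"

lemma covering_cong_closed:
  assumes A: "quandle A" and "(a, b) \<in> covering_cong A f"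
  shows "a \<in> carrier A" "b \<in> carrier A"
proof -
  have "a \<in> carrier A \<and> b \<in> carrier A"
    using assms(2) by induction (auto simp: quandle.op_closed[OF A] quandle.inv_closed[OF A])
  then show "a \<in> carrier A" "b \<in> carrier A" by auto
qed

text \<open>The kernel of a homomorphism is a congruence, so only the generating pairs need
  checking. It is applied to \<open>f\<close> itself, to see that \<open>f\<close> descends to the
  quotient, and to homomorphisms into the domain of a covering.\<close>

lemma covering_cong_subset_kernel:
  assumes A: "quandle A" and h: "h \<in> quandle_hom A C"
    and const: "\<And>a a' c. \<lbrakk>a \<in> carrier A; a' \<in> carrier A; c \<in> carrier A; f a = f a'\<rbrakk>
      \<Longrightarrow> h (c \<triangleleft>\<^bsub>A\<^esub> a) = h (c \<triangleleft>\<^bsub>A\<^esub> a')"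
    and "(a, b) \<in> covering_cong A f"
  shows "h a = h b"
  using assms(4)
proof induction
  case (op a a' b b')
  then show ?case
    using covering_cong_closed[OF A op.hyps(1)] covering_cong_closed[OF A op.hyps(2)]
    by (simp add: hom_op[OF h])
next
  case (inv a a' b b')
  then show ?case
    using covering_cong_closed[OF A inv.hyps(1)] covering_cong_closed[OF A inv.hyps(2)]
    by (simp add: hom_inv[OF h])
next
  case (gen a a' c)
  then show ?case by (rule const)
qed simp_all

text \<open>The quotient is carried by chosen representatives, since it has to live on the same type.\<close>

definition covering_rep :: "'a quandle \<Rightarrow> ('a \<Rightarrow> 'b) \<Rightarrow> 'a \<Rightarrow> 'a" where
  "covering_rep A f a = (SOME a'. (a, a') \<in> covering_cong A f)"

definition covering_quotient :: "'a quandle \<Rightarrow> ('a \<Rightarrow> 'b) \<Rightarrow> 'a quandle" where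
  "covering_quotient A f =
     \<lparr>carrier = covering_rep A f ` carrier A,
      qop = (\<lambda>a b. covering_rep A f (a \<triangleleft>\<^bsub>A\<^esub> b)),
      qinv = (\<lambda>a b. covering_rep A f (a \<triangleleft>\<inverse>\<^bsub>A\<^esub> b))\<rparr>"

context
  fixes A :: "'u quandle" and B :: "'u quandle" and f
  assumes ext: "extension A B f"
begin

private abbreviation "rep \<equiv> covering_rep A f"
private abbreviation "quot \<equiv> covering_quotient A f"
private abbreviation "proj \<equiv> restrict (covering_rep A f) (carrier A)"
private abbreviation "desc \<equiv> restrict f (carrier (covering_quotient A f))"

private lemma A: "quandle A" and B: "quandle B" and f: "f \<in> quandle_hom A B"
  using ext by (simp_all add: extension_def)

interpretation A: quandle A by (rule A)

private lemma rep_cong: "a \<in> carrier A \<Longrightarrow> (a, rep a) \<in> covering_cong A f"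
  unfolding covering_rep_def by (rule someI[of _ a]) (rule covering_cong.refl)

private lemma rep_eqI:
  assumes "(a, b) \<in> covering_cong A f"
  shows "rep a = rep b"
proof -
  \<comment> \<open>Congruent elements satisfy the same predicate, so \<open>SOME\<close> makes the
    same choice for both.\<close>
  have "(a, c) \<in> covering_cong A f \<longleftrightarrow> (b, c) \<in> covering_cong A f" for c
    using assms by (meson covering_cong.sym covering_cong.trans)
  then show ?thesis by (simp add: covering_rep_def)
qed

private lemma rep_closed: "a \<in> carrier A \<Longrightarrow> rep a \<in> carrier A"
  using covering_cong_closed[OF A rep_cong] by blast

private lemma rep_op: "a \<in> carrier A \<Longrightarrow> b \<in> carrier A \<Longrightarrow> rep (rep a \<triangleleft>\<^bsub>A\<^esub> rep b) = rep (a \<triangleleft>\<^bsub>A\<^esub> b)"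
  by (rule rep_eqI[symmetric]) (rule covering_cong.op[OF rep_cong rep_cong])

private lemma rep_inv: "a \<in> carrier A \<Longrightarrow> b \<in> carrier A \<Longrightarrow> rep (rep a \<triangleleft>\<inverse>\<^bsub>A\<^esub> rep b) = rep (a \<triangleleft>\<inverse>\<^bsub>A\<^esub> b)"
  by (rule rep_eqI[symmetric]) (rule covering_cong.inv[OF rep_cong rep_cong])

private lemma carrier_quot: "carrier quot = rep ` carrier A"
  and op_quot: "a \<in> carrier A \<Longrightarrow> b \<in> carrier A \<Longrightarrow> rep a \<triangleleft>\<^bsub>quot\<^esub> rep b = rep (a \<triangleleft>\<^bsub>A\<^esub> b)"
  and inv_quot: "a \<in> carrier A \<Longrightarrow> b \<in> carrier A \<Longrightarrow> rep a \<triangleleft>\<inverse>\<^bsub>quot\<^esub> rep b = rep (a \<triangleleft>\<inverse>\<^bsub>A\<^esub> b)"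
  by (simp_all add: covering_quotient_def rep_op rep_inv)

text \<open>Generating pairs have equal images because \<open>f\<close> is a homomorphism, so
  congruence classes lie inside the fibres of \<open>f\<close>.\<close>

private lemma f_rep: "a \<in> carrier A \<Longrightarrow> f (rep a) = f a"
  by (rule covering_cong_subset_kernel[OF A f _ rep_cong, symmetric]) (simp_all add: hom_op[OF f])

private lemma quandle_quot: "quandle quot"
proof
  fix x y z
  assume "x \<in> carrier quot" "y \<in> carrier quot" "z \<in> carrier quot"
  then obtain a b c where "x = rep a" "y = rep b" "z = rep c"
    "a \<in> carrier A" "b \<in> carrier A" "c \<in> carrier A"
    unfolding carrier_quot by blast
  then show "(x \<triangleleft>\<^bsub>quot\<^esub> y) \<triangleleft>\<^bsub>quot\<^esub> z = (x \<triangleleft>\<^bsub>quot\<^esub> z) \<triangleleft>\<^bsub>quot\<^esub> (y \<triangleleft>\<^bsub>quot\<^esub> z)"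
    using A.self_distrib[of a b c] by (simp add: op_quot A.op_closed)
qed (auto simp: carrier_quot op_quot inv_quot A.op_closed A.inv_closed A.idem A.op_inv A.inv_op)

private lemma proj_hom: "proj \<in> quandle_hom A quot"
  by (intro quandle_homI) (auto simp: carrier_quot op_quot inv_quot A.op_closed A.inv_closed)

private lemma extension_proj: "extension A quot proj"
  using A quandle_quot proj_hom by (simp add: extension_def carrier_quot)

text \<open>Representatives are elements of \<open>A\<close>, so the induced map on the quotient is
  just \<open>h\<close> restricted to them.\<close>

lemma descended_hom:
  assumes h: "h \<in> quandle_hom A C"
    and const: "\<And>a b. (a, b) \<in> covering_cong A f \<Longrightarrow> h a = h b"
  shows "restrict h (carrier quot) \<in> quandle_hom quot C"
proof -
  have h_rep: "restrict h (carrier quot) (rep a) = h a" if "a \<in> carrier A" for a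
    using const[OF rep_cong[OF that]] that by (simp add: carrier_quot)
  show ?thesis
  proof (rule quandle_homI)
    fix x y assume "x \<in> carrier quot" "y \<in> carrier quot"
    then obtain a b where "x = rep a" "y = rep b" "a \<in> carrier A" "b \<in> carrier A"
      unfolding carrier_quot by blast
    then show "restrict h (carrier quot) (x \<triangleleft>\<^bsub>quot\<^esub> y)
        = restrict h (carrier quot) x \<triangleleft>\<^bsub>C\<^esub> restrict h (carrier quot) y"
      and "restrict h (carrier quot) (x \<triangleleft>\<inverse>\<^bsub>quot\<^esub> y)
        = restrict h (carrier quot) x \<triangleleft>\<inverse>\<^bsub>C\<^esub> restrict h (carrier quot) y"
      by (simp_all only: op_quot inv_quot h_rep A.op_closed A.inv_closed hom_op[OF h] hom_inv[OF h])
  qed (auto simp: carrier_quot rep_closed hom_closed[OF h])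
qed

private lemma desc_hom: "desc \<in> quandle_hom quot B"
proof (rule descended_hom[OF f])
  fix a b assume "(a, b) \<in> covering_cong A f"
  then show "f a = f b"
    by (rule covering_cong_subset_kernel[OF A f, rotated]) (simp add: hom_op[OF f])
qed

lemma extension_covering_quotient: "extension quot B desc"
proof -
  have "f ` rep ` carrier A = f ` carrier A"
    by (auto simp: image_image f_rep)
  then show ?thesis
    using ext quandle_quot B desc_hom by (simp add: extension_def carrier_quot)
qed

text \<open>Representatives with equal values under \<open>desc\<close> have equal values under
  \<open>f\<close>, so their translates of \<open>c\<close> in \<open>A\<close> form a generating
  pair of the congruence.\<close>

lemma covering_covering_quotient: "covering quot B desc"
proof -
  have "c \<triangleleft>\<^bsub>quot\<^esub> a = c \<triangleleft>\<^bsub>quot\<^esub> a'"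
    if a: "a \<in> carrier quot" "a' \<in> carrier quot" "desc a = desc a'" and c: "c \<in> carrier quot" for a a' c
  proof -
    have "a \<in> carrier A" "a' \<in> carrier A" "c \<in> carrier A"
      using a c rep_closed by (auto simp: carrier_quot)
    then show ?thesis
      using a rep_eqI[OF covering_cong.gen, of a a' c] by (simp add: covering_quotient_def)
  qed
  then show ?thesis
    using extension_covering_quotient unfolding covering_def by blast
qed

section \<open>The universal property of the unit\<close>

private abbreviation "refl_obj \<equiv> (quot, B, desc)"
private abbreviation "refl_unit \<equiv> (proj, \<lambda>b\<in>carrier B. b)"

private lemma unit_Hom: "refl_unit \<in> Hom Ext_Qnd (A, B, f) refl_obj"
  using proj_hom B by (simp add: Hom_Ext_Qnd carrier_quot f_rep hom_closed[OF f] quandle_hom_id)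

text \<open>Shared by the reflection and the coequalizer: whatever the target,
  \<open>h\<^sub>1\<close> need only respect the congruence. The lower component of the
  factorization is forced to be \<open>h\<^sub>0\<close>, as the unit is the identity on
  \<open>B\<close>, and the upper one is unique because \<open>proj\<close> is onto.\<close>

private lemma factor_through_unit:
  assumes h: "(h\<^sub>1, h\<^sub>0) \<in> Hom Ext_Qnd (A, B, f) (A', B', g)"
    and const: "\<And>a b. (a, b) \<in> covering_cong A f \<Longrightarrow> h\<^sub>1 a = h\<^sub>1 b"
  shows "\<exists>!k. k \<in> Hom Ext_Qnd refl_obj (A', B', g) \<and>
    Comp Ext_Qnd (A, B, f) refl_obj (A', B', g) k refl_unit = (h\<^sub>1, h\<^sub>0)"
proof -
  have h1: "h\<^sub>1 \<in> quandle_hom A A'" and h0: "h\<^sub>0 \<in> quandle_hom B B'"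
    and h10: "\<And>a. a \<in> carrier A \<Longrightarrow> h\<^sub>0 (f a) = g (h\<^sub>1 a)"
    using h by (auto simp: Hom_Ext_Qnd)
  let ?k = "restrict h\<^sub>1 (carrier quot)"
  have k: "?k \<in> quandle_hom quot A'" by (rule descended_hom[OF h1 const])
  have k_proj: "compose (carrier A) ?k proj = h\<^sub>1"
    using const[OF rep_cong]
    by (intro extensionalityI[of _ "carrier A"])
      (simp_all add: hom_extensional[OF h1] compose_def carrier_quot)
  have id: "compose (carrier B) k\<^sub>0 (\<lambda>b\<in>carrier B. b) = k\<^sub>0" if "k\<^sub>0 \<in> quandle_hom B B'" for k\<^sub>0
    using hom_extensional[OF that]
    by (intro extensionalityI[of _ "carrier B"]) (simp_all add: compose_def)
  show ?thesis
  proof (rule ex1I[of _ "(?k, h\<^sub>0)"], rule conjI)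
    show "(?k, h\<^sub>0) \<in> Hom Ext_Qnd refl_obj (A', B', g)"
      using k h0 h10 rep_closed by (auto simp: Hom_Ext_Qnd carrier_quot)
    show "Comp Ext_Qnd (A, B, f) refl_obj (A', B', g) (?k, h\<^sub>0) refl_unit = (h\<^sub>1, h\<^sub>0)"
      by (simp add: Comp_Ext_Qnd k_proj id[OF h0])
  next
    fix k assume asm: "k \<in> Hom Ext_Qnd refl_obj (A', B', g) \<and>
      Comp Ext_Qnd (A, B, f) refl_obj (A', B', g) k refl_unit = (h\<^sub>1, h\<^sub>0)"
    obtain k\<^sub>1 k\<^sub>0 where k_eq: "k = (k\<^sub>1, k\<^sub>0)" by (cases k)
    then have k1: "k\<^sub>1 \<in> quandle_hom quot A'" "compose (carrier A) k\<^sub>1 proj = h\<^sub>1"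
      and k0: "k\<^sub>0 \<in> quandle_hom B B'" "compose (carrier B) k\<^sub>0 (\<lambda>b\<in>carrier B. b) = h\<^sub>0"
      using asm by (simp_all add: Hom_Ext_Qnd Comp_Ext_Qnd)
    have "k\<^sub>1 = ?k"
      by (rule extension_cancel[OF extension_proj hom_extensional[OF k1(1)] hom_extensional[OF k]])
        (simp only: k1 k_proj)
    moreover have "k\<^sub>0 = h\<^sub>0" using id[OF k0(1)] k0(2) by simp
    ultimately show "k = (?k, h\<^sub>0)" by (simp add: k_eq)
  qed
qed

lemma reflection_arrow_covering_quotient:
  assumes inf: "infinite (UNIV :: 'u set)"
  shows "reflection_arrow Ext_Qnd CExt_Qnd (A, B, f) refl_obj refl_unit"
  unfolding reflection_arrow_def
proof (intro conjI ballI unit_Hom)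
  have Obj_CExt: "(A', B', g) \<in> Obj CExt_Qnd \<longleftrightarrow> covering A' B' g" for A' B' :: "'u quandle" and g
    using central_extension_iff_covering[OF inf]
    by (auto simp: CExt_Qnd_def Obj_Ext_Qnd covering_def)
  then show "refl_obj \<in> Obj CExt_Qnd"
    using covering_covering_quotient by simp
  fix Z h
  assume Z: "Z \<in> Obj CExt_Qnd" and h: "h \<in> Hom Ext_Qnd (A, B, f) Z"
  obtain A' B' g where Z_eq: "Z = (A', B', g)" by (cases Z)
  obtain h\<^sub>1 h\<^sub>0 where h_eq: "h = (h\<^sub>1, h\<^sub>0)" by (cases h)
  have g: "covering A' B' g" using Z by (simp add: Z_eq Obj_CExt)
  have h': "(h\<^sub>1, h\<^sub>0) \<in> Hom Ext_Qnd (A, B, f) (A', B', g)" using h by (simp add: h_eq Z_eq)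
  then have h1: "h\<^sub>1 \<in> quandle_hom A A'" and sq: "\<And>a. a \<in> carrier A \<Longrightarrow> h\<^sub>0 (f a) = g (h\<^sub>1 a)"
    by (auto simp: Hom_Ext_Qnd)
  \<comment> \<open>Commutativity of the square gives
    \<open>g (h\<^sub>1 a) = g (h\<^sub>1 a')\<close>, so \<open>h\<^sub>1 a\<close> and
    \<open>h\<^sub>1 a'\<close> act equally on the domain of the covering \<open>g\<close>.\<close>
  have "h\<^sub>1 (c \<triangleleft>\<^bsub>A\<^esub> a) = h\<^sub>1 (c \<triangleleft>\<^bsub>A\<^esub> a')"
    if "a \<in> carrier A" "a' \<in> carrier A" "c \<in> carrier A" "f a = f a'" for a a' c
    using covering_op[OF g hom_closed[OF h1] hom_closed[OF h1] hom_closed[OF h1], of a a' c]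
      that sq[of a] sq[of a'] by (simp add: hom_op[OF h1])
  then have "h\<^sub>1 a = h\<^sub>1 b" if "(a, b) \<in> covering_cong A f" for a b
    using covering_cong_subset_kernel[OF A h1 _ that] by blast
  from factor_through_unit[OF h' this]
  show "\<exists>!k. k \<in> Hom Ext_Qnd refl_obj Z \<and> Comp Ext_Qnd (A, B, f) refl_obj Z k refl_unit = h"
    by (simp only: Z_eq h_eq)
qed

text \<open>The parallel pair is the kernel pair of \<open>proj\<close>, copied to \<open>'u\<close>
  by \<open>j\<close>. An object of \<open>Ext_Qnd\<close> also needs a surjection onto a base;
  \<open>k\<close>, the common composite of both projections with \<open>f\<close>, serves, and both
  arrows then lie over the identity of \<open>B\<close>.\<close>

lemma regular_epi_covering_quotient:
  assumes inf: "infinite (UNIV :: 'u set)"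
  shows "regular_epi Ext_Qnd (A, B, f) refl_obj refl_unit"
proof -
  obtain j :: "'u \<times> 'u \<Rightarrow> 'u" where "inj j" using infinite_inj_pair[OF inf] by blast
  let ?P = "pullback_quandle A A proj proj"
  have j: "inj_on j (carrier ?P)" using \<open>inj j\<close> by (rule inj_on_subset) simp
  have P: "quandle ?P" by (rule quandle_pullback_quandle[OF A A proj_hom proj_hom])
  define K where "K = image_quandle j ?P"
  define \<kappa> where "\<kappa> = (\<lambda>x\<in>j ` carrier ?P. inv_into (carrier ?P) j x)"
  define u where "u = compose (carrier K) fst \<kappa>"
  define v where "v = compose (carrier K) snd \<kappa>"
  define k where "k = compose (carrier K) f u"
  have K: "quandle K" unfolding K_def by (rule quandle_image_quandle[OF P j])
  have \<kappa>: "\<kappa> \<in> quandle_hom K ?P" unfolding K_def \<kappa>_def by (rule inv_into_hom_image_quandle[OF P j])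
  have \<kappa>_j: "j (a, b) \<in> carrier K" "\<kappa> (j (a, b)) = (a, b)"
    if "a \<in> carrier A" "b \<in> carrier A" "rep a = rep b" for a b
  proof -
    have ab: "(a, b) \<in> carrier ?P" using that by simp
    then show "j (a, b) \<in> carrier K" unfolding K_def carrier_image_quandle by (rule imageI)
    show "\<kappa> (j (a, b)) = (a, b)" using ab j by (simp only: \<kappa>_def restrict_apply' imageI inv_into_f_f)
  qed
  have u: "u \<in> quandle_hom K A" and v: "v \<in> quandle_hom K A"
    unfolding u_def v_def compose_def using hom_closed[OF \<kappa>]
    by (auto intro!: quandle_homI simp: quandle.op_closed[OF K] quandle.inv_closed[OF K]
        hom_op[OF \<kappa>] hom_inv[OF \<kappa>])
  have rep_uv: "rep (u x) = rep (v x)" and uv_closed: "u x \<in> carrier A" "v x \<in> carrier A"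
    if "x \<in> carrier K" for x
    using hom_closed[OF \<kappa> that] that by (auto simp: u_def v_def compose_def)
  have f_uv: "f (u x) = f (v x)" if "x \<in> carrier K" for x
    using f_rep uv_closed[OF that] rep_uv[OF that] by metis
  have k: "k \<in> quandle_hom K B" unfolding k_def by (rule quandle_hom_compose[OF K u f])
  have "b \<in> k ` carrier K" if b: "b \<in> carrier B" for b
  proof -
    obtain a where a: "a \<in> carrier A" "f a = b" using extension_surj[OF ext b] .
    \<comment> \<open>The diagonal of the kernel pair suffices to make \<open>k\<close>
      onto.\<close>
    then have "k (j (a, a)) = b" by (simp add: k_def u_def compose_def \<kappa>_j)
    then show ?thesis using \<kappa>_j(1)[OF a(1) a(1) HOL.refl] by blast
  qed
  then have "k ` carrier K = carrier B" using hom_closed[OF k] by blast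
  then have K_obj: "(K, B, k) \<in> Obj Ext_Qnd"
    using K B k by (simp add: Obj_Ext_Qnd extension_def)
  let ?i = "\<lambda>b\<in>carrier B. b"
  have UV: "(u, ?i) \<in> Hom Ext_Qnd (K, B, k) (A, B, f)" "(v, ?i) \<in> Hom Ext_Qnd (K, B, k) (A, B, f)"
    using u v hom_closed[OF k] quandle_hom_id[OF B]
    by (auto simp: Hom_Ext_Qnd k_def compose_def f_uv)
  have "compose (carrier K) proj u = compose (carrier K) proj v"
    using rep_uv uv_closed by (auto simp: compose_def fun_eq_iff)
  then have eq: "Comp Ext_Qnd (K, B, k) (A, B, f) refl_obj refl_unit (u, ?i)
      = Comp Ext_Qnd (K, B, k) (A, B, f) refl_obj refl_unit (v, ?i)"
    by (simp add: Comp_Ext_Qnd)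
  have "\<exists>!m. m \<in> Hom Ext_Qnd refl_obj Z \<and> Comp Ext_Qnd (A, B, f) refl_obj Z m refl_unit = h"
    if h: "h \<in> Hom Ext_Qnd (A, B, f) Z"
      and h_eq: "Comp Ext_Qnd (K, B, k) (A, B, f) Z h (u, ?i) = Comp Ext_Qnd (K, B, k) (A, B, f) Z h (v, ?i)"
    for Z h
  proof -
    obtain A' B' g where Z: "Z = (A', B', g)" by (cases Z)
    obtain h\<^sub>1 h\<^sub>0 where hh: "h = (h\<^sub>1, h\<^sub>0)" by (cases h)
    have "compose (carrier K) h\<^sub>1 u = compose (carrier K) h\<^sub>1 v"
      using h_eq by (simp add: Z hh Comp_Ext_Qnd)
    then have *: "h\<^sub>1 (u x) = h\<^sub>1 (v x)" if "x \<in> carrier K" for x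
      using that by (metis compose_eq)
    \<comment> \<open>Congruent elements form a point of the kernel pair, so a map that equalizes
      \<open>u\<close> and \<open>v\<close> respects the congruence.\<close>
    have "h\<^sub>1 a = h\<^sub>1 b" if "(a, b) \<in> covering_cong A f" for a b
      using *[of "j (a, b)"] \<kappa>_j[OF covering_cong_closed[OF A that] rep_eqI[OF that]]
      by (simp add: u_def v_def compose_def)
    from factor_through_unit[OF _ this] h show ?thesis
      by (simp only: Z hh)
  qed
  moreover have "refl_obj \<in> Obj Ext_Qnd" "(A, B, f) \<in> Obj Ext_Qnd"
    using extension_covering_quotient ext by (simp_all add: Obj_Ext_Qnd)
  ultimately have "is_coequalizer Ext_Qnd (K, B, k) (A, B, f) (u, ?i) (v, ?i) refl_obj refl_unit"
    using K_obj UV unit_Hom eq unfolding is_coequalizer_def by blast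
  then show ?thesis unfolding regular_epi_def by blast
qed

end

theorem mainTheorem4:
  assumes "infinite (UNIV :: 'u set)"
  shows "(\<exists>F \<eta> \<epsilon>. adjunction (Ext_Qnd :: ('u quandle_arrow, 'u quandle_square) category) CExt_Qnd
            F inclusion_functor \<eta> \<epsilon>) \<and>
         (\<forall>F \<eta> \<epsilon>. adjunction (Ext_Qnd :: ('u quandle_arrow, 'u quandle_square) category) CExt_Qnd
            F inclusion_functor \<eta> \<epsilon> \<longrightarrow>
            (\<forall>x\<in>Obj Ext_Qnd. regular_epi Ext_Qnd x (fobj F x) (\<eta> x)))"
proof -
  let ?C = "Ext_Qnd :: ('u quandle_arrow, 'u quandle_square) category"
  have D: "CExt_Qnd = full_subcategory ?C (\<lambda>(A, B, f). central_extension A B f)"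
    by (rule CExt_Qnd_def)
  have ex: "\<exists>y r. reflection_arrow ?C CExt_Qnd x y r \<and> regular_epi ?C x y r" if "x \<in> Obj ?C" for x
  proof -
    obtain A B f where x: "x = (A, B, f)" by (cases x)
    then have "extension A B f" using that by (simp add: Obj_Ext_Qnd)
    then show ?thesis
      using reflection_arrow_covering_quotient regular_epi_covering_quotient assms
      unfolding x by blast
  qed
  then obtain R r where R: "\<And>x. x \<in> Obj ?C \<Longrightarrow> reflection_arrow ?C CExt_Qnd x (R x) (r x)"
    by metis
  show ?thesis
  proof (intro conjI allI impI ballI)
    show "\<exists>F \<eta> \<epsilon>. adjunction ?C CExt_Qnd F inclusion_functor \<eta> \<epsilon>"
      using adjunction_of_reflections[OF is_category_Ext_Qnd D R] by blast
    fix F \<eta> \<epsilon> x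
    assume adj: "adjunction ?C CExt_Qnd F inclusion_functor \<eta> \<epsilon>" and x: "x \<in> Obj ?C"
    \<comment> \<open>Regularity is known for one universal arrow only; \<open>F\<close> and
      \<open>\<eta>\<close> are arbitrary here, so it has to be carried over to
      \<open>\<eta> x\<close>.\<close>
    obtain y r where y: "reflection_arrow ?C CExt_Qnd x y r" "regular_epi ?C x y r"
      using ex[OF x] by blast
    have "Obj CExt_Qnd \<subseteq> Obj ?C" by (auto simp: D)
    then show "regular_epi ?C x (fobj F x) (\<eta> x)"
      using regular_epi_reflection_arrow_cong[OF is_category_Ext_Qnd _ x y(1) _ y(2)]
        adjunction_unit_reflection_arrow[OF is_category_Ext_Qnd D adj x] by blast
  qed
qed

end
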